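(* If $k,m>1$, then the centered probabilistic intersection ring $\mathrm H_{\mathbb E}(G(k,m))$ of the real Grassmannian $G(k,m)=\mathrm O(k+m)/(\mathrm O(k)\times\mathrm O(m))$ is an infinite dimensional real vector space.
   Context: For a finite-dimensional Euclidean space $W$, $\widehat{\mathcal Z}_o(W)$ is the real vector space of formal differences (Minkowski addition) of centered zonoids (zonoids = Hausdorff limits of finite Minkowski sums of segments; centered = symmetric about $0$). For an integrable random vector $\xi\in W$, $K(\xi)$ is the centered zonoid with support function $\frac12\mathbb E|\langle u,\xi\rangle|$; every centered zonoid is of this form. For a Euclidean space $V$, $\Lambda^dV$ has the induced inner product. $\widehat{\mathcal G}_o^d(V)\subseteq\widehat{\mathcal Z}_o(\Lambda^dV)$ is the span of the $K(\xi)$ with $\xi\in\Lambda^dV$ integrable and a.s. simple ($=v_1\wedge\dots\wedge v_d$). With the pairing determined bilinearly by $\langle K(\xi),K(\zeta)\rangle=\mathbb E|\langle\xi,\zeta\rangle|$ ($\xi,\zeta$ independent), $\mathcal I^d(V)=\{K\in\widehat{\mathcal G}_o^d(V):\langle K,L\rangle=0\ \forall L\in\widehat{\mathcal G}_o^d(V)\}$, and $\mathcal Q_o(V)=\bigoplus_d\widehat{\mathcal G}_o^d(V)/\mathcal I^d(V)$ (a graded algebra with product $K(\xi_1)\wedge K(\xi_2)=K(\xi_1\wedge\xi_2)$ for independent $\xi_i$). The cotangent space of $G(k,m)$ at the base point is $V=\mathbb R^k\otimes\mathbb R^m$ with the tensor action of the stabilizer $H=\mathrm O(k)\times\mathrm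 O(m)$, and $\mathrm H_{\mathbb E}(G(k,m)):=\mathcal Q_o(V)^H$ (the $H$-invariants, where $h\in H$ acts by $hK(\xi)=K(h\xi)$). *)

theory Defs
  imports "HOL-Probability.Probability" "HOL-Library.Set_Algebras"
begin

text \<open>Minkowski addition is the pointwise addition of sets from \<^theory>\<open>HOL-Library.Set_Algebras\<close>;
  its neutral element, the empty sum, is \<open>{0}\<close>.\<close>

definition zonotope :: "'a::euclidean_space set \<Rightarrow> bool" where
  "zonotope P \<longleftrightarrow> (\<exists>ss. P = sum_list (map (\<lambda>(a, b). closed_segment a b) ss))"

definition hausdorff_dist :: "'a::metric_space set \<Rightarrow> 'a set \<Rightarrow> real" where
  "hausdorff_dist A B =
     Inf {e. 0 \<le> e \<and> A \<subseteq> (\<Union>b\<in>B. cball b e) \<and> B \<subseteq> (\<Union>a\<in>A. cball a e)}"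

text \<open>The limits are taken in the space of non-empty compact sets, on which the Hausdorff distance
  is a metric.\<close>

definition zonoid :: "'a::euclidean_space set \<Rightarrow> bool" where
  "zonoid Z \<longleftrightarrow> compact Z \<and> Z \<noteq> {} \<and>
     (\<exists>P. (\<forall>n. zonotope (P n)) \<and> (\<lambda>n. hausdorff_dist (P n) Z) \<longlonglongrightarrow> 0)"

lemma zonotope_add: "zonotope P \<Longrightarrow> zonotope Q \<Longrightarrow> zonotope (P + Q)"
proof -
  assume "zonotope P" "zonotope Q"
  then obtain ss ts where "P = sum_list (map (\<lambda>(a, b). closed_segment a b) ss)"
    "Q = sum_list (map (\<lambda>(a, b). closed_segment a b) ts)" by (auto simp: zonotope_def)
  then have "P + Q = sum_list (map (\<lambda>(a, b). closed_segment a b) (ss @ ts))" by simp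
  then show "zonotope (P + Q)" unfolding zonotope_def by blast
qed

lemma compact_set_plus:
  fixes A B :: "'a::real_normed_vector set"
  assumes "compact A" "compact B" shows "compact (A + B)"
proof -
  have "A + B = {x + y |x y. x \<in> A \<and> y \<in> B}" by (auto simp: set_plus_def)
  then show ?thesis using compact_sums[OF assms] by simp
qed

lemma set_plus_nonempty: "A \<noteq> {} \<Longrightarrow> B \<noteq> {} \<Longrightarrow> A + B \<noteq> {}"
  by (auto simp: set_plus_def)

lemma zonotope_convex_compact: 
  assumes "zonotope P" shows "convex P \<and> compact P \<and> P \<noteq> {}"
proof -
  have "convex (sum_list (map (\<lambda>(a, b). closed_segment a b) ss)) \<and> 
     compact (sum_list (map (\<lambda>(a, b). closed_segment a b) ss)) \<and> 
     sum_list (map (\<lambda>(a, b). closed_segment a b) ss) \<noteq> {}" for ss :: "('a \<times> 'a) list"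
  proof (induction ss)
    case Nil
    show ?case by auto
  next
    case (Cons s ss)
    obtain a b where s: "s = (a, b)" by force
    from Cons show ?case
      by (simp add: s convex_set_plus compact_set_plus set_plus_nonempty)
  qed
  then show ?thesis using assms by (auto simp: zonotope_def)
qed

lemma linear_image_set_plus: 
  assumes "linear f" shows "f ` (A + B) = f ` A + f ` B"
proof -
  have "f ` (A + B) = (\<lambda>(x, y). f (x + y)) ` (A \<times> B)"
    unfolding set_plus_image image_image by (intro image_cong) auto
  also have "\<dots> = (\<lambda>(x, y). f x + f y) ` (A \<times> B)" by (simp add: linear_add[OF assms])
  also have "\<dots> = f ` A + f ` B" by (auto simp: set_plus_image image_iff)
  finally show ?thesis .
qed

lemma zonotope_linear_image: 
  fixes f :: "'a::euclidean_space \<Rightarrow> 'b::euclidean_space"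
  assumes "linear f" "zonotope P" shows "zonotope (f ` P)"
proof -
  have "f ` sum_list (map (\<lambda>(a, b). closed_segment a b) ss) =
     sum_list (map (\<lambda>(a, b). closed_segment a b) (map (map_prod f f) ss))" for ss
  proof (induction ss)
    case Nil show ?case using linear_0[OF assms(1)] by simp
  next
    case (Cons s ss)
    then show ?case
      by (cases s) (simp add: linear_image_set_plus[OF assms(1)] closed_segment_linear_image[OF assms(1)])
  qed
  then show ?thesis using assms(2) unfolding zonotope_def by metis
qed

lemma hausdorff_dist_le:
  assumes "0 \<le> e" "A \<subseteq> (\<Union>b\<in>B. cball b e)" "B \<subseteq> (\<Union>a\<in>A. cball a e)"
  shows "hausdorff_dist A B \<le> e" "0 \<le> hausdorff_dist A B"
proof -
  let ?E = "{e. 0 \<le> e \<and> A \<subseteq> (\<Union>b\<in>B. cball b e) \<and> B \<subseteq> (\<Union>a\<in>A. cball a e)}"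
  have "e \<in> ?E" using assms by simp
  moreover have "bdd_below ?E" by (rule bdd_belowI[of _ 0]) simp
  ultimately show "hausdorff_dist A B \<le> e" unfolding hausdorff_dist_def by (rule cInf_lower)
  show "0 \<le> hausdorff_dist A B" unfolding hausdorff_dist_def
    by (rule cInf_greatest) (use \<open>e \<in> ?E\<close> in blast, simp)
qed

lemma hausdorff_dist_less:
  assumes "bounded A" "bounded B" "A \<noteq> {}" "B \<noteq> {}" "hausdorff_dist A B < e"
  shows "A \<subseteq> (\<Union>b\<in>B. cball b e)" "B \<subseteq> (\<Union>a\<in>A. cball a e)"
proof -
  define E where "E = {e. 0 \<le> e \<and> A \<subseteq> (\<Union>b\<in>B. cball b e) \<and> B \<subseteq> (\<Union>a\<in>A. cball a e)}"
  obtain a0 b0 where ab: "a0 \<in> A" "b0 \<in> B" using assms by auto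
  obtain c where c: "\<And>x. x \<in> A \<Longrightarrow> dist b0 x \<le> c" 
    using assms(1) bounded_any_center[of A b0] by auto
  obtain d where d: "\<And>x. x \<in> B \<Longrightarrow> dist a0 x \<le> d" 
    using assms(2) bounded_any_center[of B a0] by auto
  have "A \<subseteq> (\<Union>b\<in>B. cball b (max 0 (max c d)))" 
    using c ab(2) by (auto intro!: bexI[of _ b0] simp: le_max_iff_disj)
  moreover have "B \<subseteq> (\<Union>a\<in>A. cball a (max 0 (max c d)))"
    using d ab(1) by (auto intro!: bexI[of _ a0] simp: le_max_iff_disj)
  ultimately have "max 0 (max c d) \<in> E" unfolding E_def by simp
  then have "E \<noteq> {}" by auto
  moreover have "Inf E < e" using assms(5) by (simp add: hausdorff_dist_def E_def)
  ultimately obtain e' where e': "e' \<in> E" "e' < e" using cInf_lessD by blast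
  show "A \<subseteq> (\<Union>b\<in>B. cball b e)" "B \<subseteq> (\<Union>a\<in>A. cball a e)"
  proof -
    have "(\<Union>b\<in>X. cball b e') \<subseteq> (\<Union>b\<in>X. cball b e)" for X :: "'a set"
      using e'(2) by (auto intro: order_trans less_imp_le)
    then show "A \<subseteq> (\<Union>b\<in>B. cball b e)" "B \<subseteq> (\<Union>a\<in>A. cball a e)"
      using e'(1) unfolding E_def by blast+
  qed
qed

lemma zonoid_iff:
  "zonoid Z \<longleftrightarrow> compact Z \<and> Z \<noteq> {} \<and> 
     (\<forall>e>0. \<exists>P. zonotope P \<and> P \<subseteq> (\<Union>z\<in>Z. cball z e) \<and> Z \<subseteq> (\<Union>p\<in>P. cball p e))"
    (is "?l \<longleftrightarrow> ?r")
proof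
  assume l: ?l
  then obtain P where P: "\<And>n. zonotope (P n)" "(\<lambda>n. hausdorff_dist (P n) Z) \<longlonglongrightarrow> 0"
    by (auto simp: zonoid_def)
  show ?r
  proof (intro conjI allI impI)
    fix e :: real assume "e > 0"
    then have "eventually (\<lambda>n. hausdorff_dist (P n) Z < e) sequentially"
      using P(2) by (simp add: order_tendstoD(2))
    then obtain n where n: "hausdorff_dist (P n) Z < e" by (auto simp: eventually_sequentially)
    have "bounded (P n)" "bounded Z" "P n \<noteq> {}" "Z \<noteq> {}" 
      using zonotope_convex_compact[OF P(1)[of n]] l by (auto simp: zonoid_def compact_imp_bounded)
    from hausdorff_dist_less[OF this n] P(1) 
    show "\<exists>P. zonotope P \<and> P \<subseteq> (\<Union>z\<in>Z. cball z e) \<and> Z \<subseteq> (\<Union>p\<in>P. cball p e)" by blast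
  qed (use l in \<open>auto simp: zonoid_def\<close>)
next
  assume r: ?r
  have "\<forall>n. \<exists>P. zonotope P \<and> P \<subseteq> (\<Union>z\<in>Z. cball z (1 / Suc n)) \<and> Z \<subseteq> (\<Union>p\<in>P. cball p (1 / Suc n))"
    using r by (metis of_nat_0_less_iff zero_less_Suc zero_less_divide_1_iff)
  then obtain P where P: "\<And>n. zonotope (P n)" "\<And>n. P n \<subseteq> (\<Union>z\<in>Z. cball z (1 / Suc n))"
     "\<And>n. Z \<subseteq> (\<Union>p\<in>P n. cball p (1 / Suc n))" by metis
  have "(\<lambda>n. hausdorff_dist (P n) Z) \<longlonglongrightarrow> 0"
  proof (rule tendsto_sandwich[OF _ _ tendsto_const LIMSEQ_Suc[OF lim_1_over_n]])
    show "\<forall>\<^sub>F n in sequentially. 0 \<le> hausdorff_dist (P n) Z"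
      using hausdorff_dist_le(2)[OF _ P(2,3)] by simp
    show "\<forall>\<^sub>F n in sequentially. hausdorff_dist (P n) Z \<le> 1 / of_nat (Suc n)"
      using hausdorff_dist_le(1)[OF _ P(2,3)] by simp
  qed
  then show ?l using P(1) r unfolding zonoid_def by blast
qed

lemma zonoid_compact: "zonoid Z \<Longrightarrow> compact Z" and zonoid_nonempty: "zonoid Z \<Longrightarrow> Z \<noteq> {}"
  by (auto simp: zonoid_def)

lemma zonotope_imp_zonoid: "zonotope P \<Longrightarrow> zonoid P"
proof -
  assume P: "zonotope P"
  have "P \<subseteq> (\<Union>b\<in>P. cball b 0)" by auto
  with hausdorff_dist_le[of 0 P P] have "hausdorff_dist P P = 0" by linarith
  then show "zonoid P" using zonotope_convex_compact[OF P] P unfolding zonoid_def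
    by (intro conjI exI[of _ "\<lambda>_. P"]) simp_all
qed

lemma zonoid_convex: 
  assumes "zonoid Z" shows "convex Z"
proof (rule convexI)
  fix x y :: 'a and u v :: real
  assume *: "x \<in> Z" "y \<in> Z" "0 \<le> u" "0 \<le> v" "u + v = 1"
  have "closed Z" using assms zonoid_compact compact_imp_closed by blast
  have "\<exists>z\<in>Z. dist z (u *\<^sub>R x + v *\<^sub>R y) < e" if "e > 0" for e
  proof -
    have "e / 3 > 0" using that by simp
    then obtain P where P: "zonotope P" "P \<subseteq> (\<Union>z\<in>Z. cball z (e / 3))" "Z \<subseteq> (\<Union>p\<in>P. cball p (e / 3))"
      using assms unfolding zonoid_iff by meson
    obtain p q where pq: "p \<in> P" "q \<in> P" "dist p x \<le> e / 3" "dist q y \<le> e / 3"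
      using subsetD[OF P(3) *(1)] subsetD[OF P(3) *(2)] by auto
    have "u *\<^sub>R p + v *\<^sub>R q \<in> P" 
      using zonotope_convex_compact[OF P(1)] pq * by (auto intro: convexD)
    then obtain z where z: "z \<in> Z" "dist z (u *\<^sub>R p + v *\<^sub>R q) \<le> e / 3" using subsetD[OF P(2)] by fastforce
    have "dist (u *\<^sub>R p + v *\<^sub>R q) (u *\<^sub>R x + v *\<^sub>R y) \<le> u * dist p x + v * dist q y"
    proof -
      have "(u *\<^sub>R p + v *\<^sub>R q) - (u *\<^sub>R x + v *\<^sub>R y) = u *\<^sub>R (p - x) + v *\<^sub>R (q - y)" 
        by (simp add: algebra_simps)
      then show ?thesis unfolding dist_norm 
        using norm_triangle_ineq[of "u *\<^sub>R (p - x)" "v *\<^sub>R (q - y)"] * by simp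
    qed
    also have "\<dots> \<le> u * (e / 3) + v * (e / 3)" using pq * by (intro add_mono mult_left_mono) auto
    also have "\<dots> = e / 3" using *(5) by (metis distrib_right mult_1)
    finally have "dist z (u *\<^sub>R x + v *\<^sub>R y) \<le> e / 3 + e / 3"
      using z(2) dist_triangle[of z "u *\<^sub>R x + v *\<^sub>R y" "u *\<^sub>R p + v *\<^sub>R q"] by linarith
    then show ?thesis using z(1) that by (intro bexI[of _ z]) auto
  qed
  then have "u *\<^sub>R x + v *\<^sub>R y \<in> closure Z" by (simp add: closure_approachable)
  then show "u *\<^sub>R x + v *\<^sub>R y \<in> Z" using \<open>closed Z\<close> by simp
qed

lemma zonoid_add:
  assumes "zonoid A" "zonoid B" shows "zonoid (A + B)"
  unfolding zonoid_iff
proof (intro conjI allI impI)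
  show "compact (A + B)" by (intro compact_set_plus zonoid_compact assms)
  show "A + B \<noteq> {}" by (intro set_plus_nonempty zonoid_nonempty assms)
  fix e :: real assume "e > 0"
  then have e: "e / 2 > 0" by simp
  obtain P where P: "zonotope P" "P \<subseteq> (\<Union>z\<in>A. cball z (e / 2))" "A \<subseteq> (\<Union>p\<in>P. cball p (e / 2))"
    using assms(1) e unfolding zonoid_iff by meson
  obtain Q where Q: "zonotope Q" "Q \<subseteq> (\<Union>z\<in>B. cball z (e / 2))" "B \<subseteq> (\<Union>p\<in>Q. cball p (e / 2))"
    using assms(2) e unfolding zonoid_iff by meson
  have *: "X + Y \<subseteq> (\<Union>p\<in>X' + Y'. cball p e)" 
    if X: "X \<subseteq> (\<Union>z\<in>X'. cball z (e / 2))" and Y: "Y \<subseteq> (\<Union>z\<in>Y'. cball z (e / 2))" for X X' Y Y' :: "'a set"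
  proof
    fix w assume "w \<in> X + Y"
    then obtain x y where w: "w = x + y" "x \<in> X" "y \<in> Y" by (auto simp: set_plus_def)
    obtain x' y' where "x' \<in> X'" "y' \<in> Y'" "dist x' x \<le> e / 2" "dist y' y \<le> e / 2"
      using subsetD[OF X w(2)] subsetD[OF Y w(3)] by auto
    moreover from this have "dist (x' + y') (x + y) \<le> e" 
      using dist_triangle_add[of x' y' x y] by linarith
    ultimately show "w \<in> (\<Union>p\<in>X' + Y'. cball p e)" using w by auto
  qed
  show "\<exists>P. zonotope P \<and> P \<subseteq> (\<Union>z\<in>A + B. cball z e) \<and> A + B \<subseteq> (\<Union>p\<in>P. cball p e)"
    using zonotope_add[OF P(1) Q(1)] *[OF P(2) Q(2)] *[OF P(3) Q(3)] by blast
qed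

lemma zonoid_linear_image:
  fixes f :: "'a::euclidean_space \<Rightarrow> 'b::euclidean_space"
  assumes "linear f" "zonoid Z" shows "zonoid (f ` Z)"
  unfolding zonoid_iff
proof (intro conjI allI impI)
  show "compact (f ` Z)" 
    by (intro compact_continuous_image linear_continuous_on zonoid_compact assms)
       (simp add: assms(1) linear_conv_bounded_linear[symmetric])
  show "f ` Z \<noteq> {}" using assms zonoid_nonempty by auto
  fix e :: real assume "e > 0"
  obtain C where C: "C > 0" "\<And>x. norm (f x) \<le> C * norm x"
    using linear_bounded_pos[OF assms(1)] by auto
  have dist: "dist (f x) (f y) \<le> C * dist x y" for x y
    using C(2)[of "x - y"] by (simp add: dist_norm linear_diff[OF assms(1)])
  have e: "e / C > 0" using C \<open>e > 0\<close> by simp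
  obtain P where P: "zonotope P" "P \<subseteq> (\<Union>z\<in>Z. cball z (e / C))" "Z \<subseteq> (\<Union>p\<in>P. cball p (e / C))"
    using assms(2) e unfolding zonoid_iff by meson
  have *: "f ` X \<subseteq> (\<Union>p\<in>f ` Y. cball p e)" if X: "X \<subseteq> (\<Union>z\<in>Y. cball z (e / C))" for X Y
  proof
    fix w assume "w \<in> f ` X"
    then obtain x where w: "w = f x" "x \<in> X" by auto
    then obtain y where y: "y \<in> Y" "dist y x \<le> e / C" using subsetD[OF X w(2)] by auto
    then have "dist (f y) (f x) \<le> e" using dist[of y x] C 
      by (smt (verit) mult.commute pos_le_divide_eq)
    then show "w \<in> (\<Union>p\<in>f ` Y. cball p e)" using w y by auto
  qed
  show "\<exists>P. zonotope P \<and> P \<subseteq> (\<Union>z\<in>f ` Z. cball z e) \<and> f ` Z \<subseteq> (\<Union>p\<in>P. cball p e)"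
    using zonotope_linear_image[OF assms(1) P(1)] *[OF P(2)] *[OF P(3)] by blast
qed

definition support_fun :: "'a::euclidean_space set \<Rightarrow> 'a \<Rightarrow> real" where
  "support_fun K u = Sup ((\<lambda>x. u \<bullet> x) ` K)"

lemma support_fun_bdd: 
  assumes "compact K" shows "bdd_above ((\<lambda>x. u \<bullet> x) ` K)"
  by (intro bounded_imp_bdd_above compact_imp_bounded compact_continuous_image assms continuous_intros)

lemma support_fun_upper: "compact K \<Longrightarrow> x \<in> K \<Longrightarrow> u \<bullet> x \<le> support_fun K u"
  unfolding support_fun_def by (intro cSup_upper support_fun_bdd) auto

lemma support_fun_attained:
  assumes "compact K" "K \<noteq> {}"
  obtains x where "x \<in> K" "support_fun K u = u \<bullet> x"
proof -
  obtain x where x: "x \<in> K" "\<And>y. y \<in> K \<Longrightarrow> u \<bullet> y \<le> u \<bullet> x"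
    using continuous_attains_sup[OF assms, of "\<lambda>x. u \<bullet> x"] continuous_on_inner[OF continuous_on_const continuous_on_id]
    by blast
  then have "support_fun K u = u \<bullet> x" unfolding support_fun_def
    by (intro cSup_eq_maximum) auto
  with x that show ?thesis by blast
qed

lemma support_fun_eqI: 
  assumes "compact K" "K \<noteq> {}" "x \<in> K" "u \<bullet> x = c" "\<And>y. y \<in> K \<Longrightarrow> u \<bullet> y \<le> c"
  shows "support_fun K u = c"
  unfolding support_fun_def using assms by (intro cSup_eq_maximum) auto

lemma support_fun_add:
  assumes "compact A" "A \<noteq> {}" "compact B" "B \<noteq> {}"
  shows "support_fun (A + B) u = support_fun A u + support_fun B u"
proof -
  obtain a where a: "a \<in> A" "support_fun A u = u \<bullet> a" using support_fun_attained assms by blast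
  obtain b where b: "b \<in> B" "support_fun B u = u \<bullet> b" using support_fun_attained assms by blast
  have "support_fun (A + B) u = u \<bullet> (a + b)" unfolding support_fun_def
    using a b support_fun_upper[OF assms(1), of _ u] support_fun_upper[OF assms(3), of _ u]
    by (intro cSup_eq_maximum) (force simp: set_plus_def inner_add_right intro: add_mono)+
  then show ?thesis using a b by (simp add: inner_add_right)
qed

lemma support_fun_linear_image:
  fixes f :: "'a::euclidean_space \<Rightarrow> 'b::euclidean_space"
  assumes "linear f" shows "support_fun (f ` K) u = support_fun K (adjoint f u)"
  by (simp add: support_fun_def image_image adjoint_works[OF assms] inner_commute[of u] inner_commute[of "adjoint f u"])

lemma support_fun_inj:
  assumes "zonoid A" "zonoid B" "\<And>u. support_fun A u = support_fun B u"
  shows "A = B"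
proof -
  have "A \<subseteq> B" if A: "zonoid A" and B: "zonoid B" and eq: "\<And>u. support_fun A u = support_fun B u" for A B :: "'a set"
  proof
    fix x assume x: "x \<in> A"
    show "x \<in> B"
    proof (rule ccontr)
      assume "x \<notin> B"
      then obtain a b where ab: "a \<bullet> x < b" "\<And>y. y \<in> B \<Longrightarrow> b < a \<bullet> y"
        using separating_hyperplane_closed_point[of B x] zonoid_convex[OF B] 
          compact_imp_closed[OF zonoid_compact[OF B]] by blast
      obtain y where "y \<in> B" "support_fun B (-a) = (-a) \<bullet> y"
        using support_fun_attained zonoid_compact zonoid_nonempty B by blast
      moreover have "(-a) \<bullet> x \<le> support_fun A (-a)" using support_fun_upper zonoid_compact A x by blast
      ultimately show False using ab(1) ab(2)[of y] eq[of "-a"] by simp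
    qed
  qed
  from this[OF assms] this[OF assms(2,1)] assms(3) show ?thesis by auto
qed

lemma support_fun_le_imp_subset:
  fixes A B :: "'a::euclidean_space set"
  assumes A: "compact A" and B: "compact B" "convex B" "B \<noteq> {}"
    and le: "\<And>u. support_fun A u \<le> support_fun B u + e * norm u" and e: "0 \<le> e"
  shows "A \<subseteq> (\<Union>b\<in>B. cball b e)"
proof
  fix x assume x: "x \<in> A"
  let ?C = "B + cball 0 e"
  have C: "compact ?C" "convex ?C" "?C \<noteq> {}"
    using B e by (simp_all add: compact_set_plus convex_set_plus set_plus_nonempty)
  have x_le: "u \<bullet> x \<le> support_fun ?C u" for u
  proof -
    have "support_fun ?C u = support_fun B u + support_fun (cball 0 e) u"
      using B e by (intro support_fun_add) auto
    moreover have "support_fun (cball 0 e) u \<ge> e * norm u"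
    proof (cases "u = 0")
      case True
      then show ?thesis using support_fun_upper[of "cball 0 e" 0 u] e by simp
    next
      case False
      then have "u \<bullet> ((e / norm u) *\<^sub>R u) = e * norm u" 
        by (simp add: dot_square_norm power2_eq_square)
      moreover have "(e / norm u) *\<^sub>R u \<in> cball 0 e" using e False by simp
      ultimately show ?thesis using support_fun_upper[of "cball 0 e" "(e / norm u) *\<^sub>R u" u] by simp
    qed
    ultimately show ?thesis using le[of u] support_fun_upper[OF A x, of u] by linarith
  qed
  have "x \<in> ?C"
  proof (rule ccontr)
    assume "x \<notin> ?C"
    then obtain a b where ab: "a \<bullet> x < b" "\<And>y. y \<in> ?C \<Longrightarrow> b < a \<bullet> y"
      using separating_hyperplane_closed_point[OF C(2) compact_imp_closed[OF C(1)]] by blast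
    obtain y where "y \<in> ?C" "support_fun ?C (-a) = (-a) \<bullet> y"
      using support_fun_attained[OF C(1,3)] by blast
    then show False using ab(1) ab(2)[of y] x_le[of "-a"] by simp
  qed
  then obtain b c where "x = b + c" "b \<in> B" "norm c \<le> e" by (auto simp: set_plus_def)
  then show "x \<in> (\<Union>b\<in>B. cball b e)" by (auto simp: dist_norm intro!: bexI[of _ b])
qed

definition random_vector :: "'s measure \<Rightarrow> ('s \<Rightarrow> 'a::euclidean_space) \<Rightarrow> bool" where
  "random_vector M \<xi> \<longleftrightarrow> prob_space M \<and> integrable M \<xi>"

lemma simple_zonotope:
  fixes s :: "'s \<Rightarrow> 'a::euclidean_space"
  assumes "prob_space M" "simple_function M s"
  shows "\<exists>P. zonotope P \<and> (\<forall>u. support_fun P u = (\<integral>\<omega>. \<bar>u \<bullet> s \<omega>\<bar> \<partial>M) / 2)"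
proof -
  interpret prob_space M by fact
  define p where "p = (\<lambda>x. measure M {\<omega>\<in>space M. s \<omega> = x} / 2)"
  have fin: "finite (s ` space M)" using assms(2) by (simp add: simple_function_def)
  have meas: "{\<omega>\<in>space M. s \<omega> = x} \<in> sets M" for x
    using simple_functionD(2)[OF assms(2), of "{x}"] by (simp add: vimage_def Int_def conj_commute)
  obtain xs where xs: "set xs = s ` space M" "distinct xs" using finite_distinct_list[OF fin] by auto
  define ss where "ss = map (\<lambda>x. (- (p x *\<^sub>R x), p x *\<^sub>R x)) xs"
  have sf: "support_fun (closed_segment (- (c *\<^sub>R x)) (c *\<^sub>R x)) u = c * \<bar>u \<bullet> x\<bar>" if "0 \<le> c" for c u and x :: 'a
  proof -
    have *: "(closed_segment (- (c *\<^sub>R x)) (c *\<^sub>R x)) = (\<lambda>t. t *\<^sub>R (c *\<^sub>R x)) ` {-1..1}"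
    proof -
      have "linear (\<lambda>t. t *\<^sub>R (c *\<^sub>R x))" by (rule linear_scaleR_left)
      from closed_segment_linear_image[OF this, of "-1" 1] show ?thesis 
        by (simp add: closed_segment_eq_real_ivl)
    qed
    show ?thesis
    proof (rule support_fun_eqI[OF compact_segment])
      show "sgn (u \<bullet> x) *\<^sub>R (c *\<^sub>R x) \<in> closed_segment (- (c *\<^sub>R x)) (c *\<^sub>R x)"
        unfolding * by (intro imageI) (auto simp: sgn_if)
      show "u \<bullet> (sgn (u \<bullet> x) *\<^sub>R (c *\<^sub>R x)) = c * \<bar>u \<bullet> x\<bar>" by (auto simp: sgn_if)
      fix y assume "y \<in> closed_segment (- (c *\<^sub>R x)) (c *\<^sub>R x)"
      then obtain t where t: "-1 \<le> t" "t \<le> 1" "y = t *\<^sub>R (c *\<^sub>R x)" unfolding * by auto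
      then have "u \<bullet> y = c * (t * (u \<bullet> x))" by simp
      also have "\<dots> \<le> c * \<bar>u \<bullet> x\<bar>" using that t mult_right_mono[of "\<bar>t\<bar>" 1 "\<bar>u \<bullet> x\<bar>"]
        by (intro mult_left_mono) (auto simp: abs_mult intro: order_trans[OF abs_ge_self])
      finally show "u \<bullet> y \<le> c * \<bar>u \<bullet> x\<bar>" .
    qed simp
  qed
  have "support_fun (sum_list (map (\<lambda>(a, b). closed_segment a b) (map (\<lambda>x. (- (p x *\<^sub>R x), p x *\<^sub>R x)) ys))) u 
     = (\<Sum>x\<leftarrow>ys. p x * \<bar>u \<bullet> x\<bar>)" for ys u
  proof (induction ys)
    case Nil show ?case by (simp add: support_fun_def)
  next
    case (Cons y ys)
    have "zonotope (sum_list (map (\<lambda>(a, b). closed_segment a b) (map (\<lambda>x. (- (p x *\<^sub>R x), p x *\<^sub>R x)) ys)))" (is "zonotope ?S")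
      unfolding zonotope_def by blast
    note S = zonotope_convex_compact[OF this]
    have "0 \<le> p y" by (simp add: p_def)
    have "support_fun (closed_segment (- (p y *\<^sub>R y)) (p y *\<^sub>R y) + ?S) u = p y * \<bar>u \<bullet> y\<bar> + support_fun ?S u"
      using S sf[OF \<open>0 \<le> p y\<close>] by (subst support_fun_add) auto
    then show ?case using Cons by simp
  qed
  from this[of xs] have 1: "support_fun (sum_list (map (\<lambda>(a, b). closed_segment a b) ss)) u = (\<Sum>x\<in>s ` space M. p x * \<bar>u \<bullet> x\<bar>)" for u
    unfolding ss_def by (simp add: sum_list_distinct_conv_sum_set[OF xs(2)] xs(1))
  have 2: "(\<integral>\<omega>. \<bar>u \<bullet> s \<omega>\<bar> \<partial>M) = (\<Sum>x\<in>s ` space M. measure M {\<omega>\<in>space M. s \<omega> = x} * \<bar>u \<bullet> x\<bar>)" for u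
  proof -
    have "(\<integral>\<omega>. \<bar>u \<bullet> s \<omega>\<bar> \<partial>M) = (\<integral>\<omega>. (\<Sum>x\<in>s ` space M. indicator {\<omega>\<in>space M. s \<omega> = x} \<omega> * \<bar>u \<bullet> x\<bar>) \<partial>M)"
    proof (rule Bochner_Integration.integral_cong[OF refl])
      fix \<omega> assume w: "\<omega> \<in> space M"
      have "(\<Sum>x\<in>s ` space M. indicator {\<omega>\<in>space M. s \<omega> = x} \<omega> * \<bar>u \<bullet> x\<bar>) = (\<Sum>x\<in>s ` space M. if s \<omega> = x then \<bar>u \<bullet> x\<bar> else 0)"
        using w by (intro sum.cong) (auto simp: indicator_def)
      also have "\<dots> = \<bar>u \<bullet> s \<omega>\<bar>" using w fin by (simp add: sum.delta')
      finally show "\<bar>u \<bullet> s \<omega>\<bar> = (\<Sum>x\<in>s ` space M. indicator {\<omega>\<in>space M. s \<omega> = x} \<omega> * \<bar>u \<bullet> x\<bar>)" by simp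
    qed
    also have "\<dots> = (\<Sum>x\<in>s ` space M. measure M {\<omega>\<in>space M. s \<omega> = x} * \<bar>u \<bullet> x\<bar>)"
      using meas by (subst Bochner_Integration.integral_sum) (auto intro!: sum.cong simp: emeasure_eq_measure)
    finally show ?thesis .
  qed
  show ?thesis
    by (rule exI[of _ "sum_list (map (\<lambda>(a, b). closed_segment a b) ss)"])
       (unfold zonotope_def, auto simp: 1 2 p_def sum_divide_distrib)
qed

lemma exists_zonoid_of:
  fixes \<xi> :: "'s \<Rightarrow> 'a::euclidean_space"
  assumes "random_vector M \<xi>"
  shows "\<exists>Z. zonoid Z \<and> uminus ` Z = Z \<and> (\<forall>u. support_fun Z u = (\<integral>\<omega>. \<bar>u \<bullet> \<xi> \<omega>\<bar> \<partial>M) / 2)"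
proof -
  interpret prob_space M using assms by (simp add: random_vector_def)
  have int: "integrable M \<xi>" using assms by (simp add: random_vector_def)
  note [measurable] = borel_measurable_integrable[OF int]
  define \<Phi> where "\<Phi> = {\<phi> :: 's \<Rightarrow> real. \<phi> \<in> borel_measurable M \<and> (\<forall>\<omega>. \<bar>\<phi> \<omega>\<bar> \<le> 1 / 2)}"
  have int\<phi>: "integrable M (\<lambda>\<omega>. \<phi> \<omega> *\<^sub>R \<xi> \<omega>)" if "\<phi> \<in> \<Phi>" for \<phi>
  proof (rule Bochner_Integration.integrable_bound[OF int])
    show "(\<lambda>\<omega>. \<phi> \<omega> *\<^sub>R \<xi> \<omega>) \<in> borel_measurable M" 
      using that by (intro borel_measurable_scaleR) (simp_all add: \<Phi>_def)
    have "norm (\<phi> \<omega> *\<^sub>R \<xi> \<omega>) \<le> norm (\<xi> \<omega>)" for \<omega>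
    proof -
      have "\<bar>\<phi> \<omega>\<bar> \<le> 1 / 2" using that by (simp add: \<Phi>_def)
      then show ?thesis using mult_right_mono[of "\<bar>\<phi> \<omega>\<bar>" 1 "norm (\<xi> \<omega>)"] by simp
    qed
    then show "AE \<omega> in M. norm (\<phi> \<omega> *\<^sub>R \<xi> \<omega>) \<le> norm (\<xi> \<omega>)" by simp
  qed
  define S where "S = (\<lambda>\<phi>. \<integral>\<omega>. \<phi> \<omega> *\<^sub>R \<xi> \<omega> \<partial>M) ` \<Phi>"
  have inner: "u \<bullet> (\<integral>\<omega>. \<phi> \<omega> *\<^sub>R \<xi> \<omega> \<partial>M) = (\<integral>\<omega>. \<phi> \<omega> * (u \<bullet> \<xi> \<omega>) \<partial>M)" if "\<phi> \<in> \<Phi>" for \<phi> u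
    using int\<phi>[OF that] by (subst integral_inner_right[symmetric]) simp_all
  have intu: "integrable M (\<lambda>\<omega>. \<bar>u \<bullet> \<xi> \<omega>\<bar>)" for u using int by simp
  let ?h = "\<lambda>u. (\<integral>\<omega>. \<bar>u \<bullet> \<xi> \<omega>\<bar> \<partial>M) / 2"
  have S_le: "u \<bullet> x \<le> ?h u" if x: "x \<in> S" for x u
  proof -
    obtain \<phi> where \<phi>: "\<phi> \<in> \<Phi>" "x = (\<integral>\<omega>. \<phi> \<omega> *\<^sub>R \<xi> \<omega> \<partial>M)" using x by (auto simp: S_def)
    have "integrable M (\<lambda>\<omega>. \<phi> \<omega> * (u \<bullet> \<xi> \<omega>))" using integrable_inner_right[OF int\<phi>[OF \<phi>(1)], of u] by simp
    moreover have "\<phi> \<omega> * (u \<bullet> \<xi> \<omega>) \<le> \<bar>u \<bullet> \<xi> \<omega>\<bar> / 2" for \<omega>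
    proof -
      have "\<phi> \<omega> * (u \<bullet> \<xi> \<omega>) \<le> \<bar>\<phi> \<omega>\<bar> * \<bar>u \<bullet> \<xi> \<omega>\<bar>" by (metis abs_ge_self abs_mult)
      also have "\<dots> \<le> 1 / 2 * \<bar>u \<bullet> \<xi> \<omega>\<bar>" using \<phi>(1) by (intro mult_right_mono) (auto simp: \<Phi>_def)
      finally show ?thesis by simp
    qed
    ultimately have "(\<integral>\<omega>. \<phi> \<omega> * (u \<bullet> \<xi> \<omega>) \<partial>M) \<le> (\<integral>\<omega>. \<bar>u \<bullet> \<xi> \<omega>\<bar> / 2 \<partial>M)"
      using intu by (intro integral_mono) auto
    then show ?thesis using inner[OF \<phi>(1)] \<phi>(2) by simp
  qed
  have S_att: "\<exists>x\<in>S. u \<bullet> x = ?h u" for u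
  proof -
    let ?\<phi> = "\<lambda>\<omega>. sgn (u \<bullet> \<xi> \<omega>) / 2"
    have \<phi>: "?\<phi> \<in> \<Phi>" by (auto simp: \<Phi>_def sgn_if)
    have "(\<lambda>\<omega>. ?\<phi> \<omega> * (u \<bullet> \<xi> \<omega>)) = (\<lambda>\<omega>. \<bar>u \<bullet> \<xi> \<omega>\<bar> / 2)" by (auto simp: sgn_if)
    then have "u \<bullet> (\<integral>\<omega>. ?\<phi> \<omega> *\<^sub>R \<xi> \<omega> \<partial>M) = (\<integral>\<omega>. \<bar>u \<bullet> \<xi> \<omega>\<bar> / 2 \<partial>M)" 
      using inner[OF \<phi>] by presburger
    moreover have "(\<integral>\<omega>. \<bar>u \<bullet> \<xi> \<omega>\<bar> / 2 \<partial>M) = ?h u" by simp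
    moreover have "(\<integral>\<omega>. ?\<phi> \<omega> *\<^sub>R \<xi> \<omega> \<partial>M) \<in> S" unfolding S_def using \<phi> by (rule imageI)
    ultimately show ?thesis by metis
  qed
  have "convex S"
  proof (rule convexI)
    fix x y and a b :: real assume xy: "x \<in> S" "y \<in> S" and ab: "0 \<le> a" "0 \<le> b" "a + b = 1"
    obtain \<phi> \<psi> where \<phi>: "\<phi> \<in> \<Phi>" "x = (\<integral>\<omega>. \<phi> \<omega> *\<^sub>R \<xi> \<omega> \<partial>M)" and \<psi>: "\<psi> \<in> \<Phi>" "y = (\<integral>\<omega>. \<psi> \<omega> *\<^sub>R \<xi> \<omega> \<partial>M)"
      using xy by (auto simp: S_def)
    have "(\<lambda>\<omega>. a * \<phi> \<omega> + b * \<psi> \<omega>) \<in> \<Phi>"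
    proof -
      have "\<bar>a * \<phi> \<omega> + b * \<psi> \<omega>\<bar> \<le> 1 / 2" for \<omega>
      proof -
        have "\<bar>a * \<phi> \<omega> + b * \<psi> \<omega>\<bar> \<le> a * \<bar>\<phi> \<omega>\<bar> + b * \<bar>\<psi> \<omega>\<bar>" 
          using abs_triangle_ineq[of "a * \<phi> \<omega>" "b * \<psi> \<omega>"] ab by (simp add: abs_mult)
        also have "\<dots> \<le> a * (1 / 2) + b * (1 / 2)" using \<phi>(1) \<psi>(1) ab
          by (intro add_mono mult_left_mono) (auto simp: \<Phi>_def)
        also have "\<dots> = 1 / 2" using ab(3) by (simp add: field_simps)
        finally show ?thesis .
      qed
      then show ?thesis using \<phi>(1) \<psi>(1) by (auto simp: \<Phi>_def)
    qed
    moreover have "a *\<^sub>R x + b *\<^sub>R y = (\<integral>\<omega>. (a * \<phi> \<omega> + b * \<psi> \<omega>) *\<^sub>R \<xi> \<omega> \<partial>M)"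
      using int\<phi>[OF \<phi>(1)] int\<phi>[OF \<psi>(1)] by (simp add: \<phi>(2) \<psi>(2) scaleR_add_left flip: scaleR_scaleR)
    ultimately show "a *\<^sub>R x + b *\<^sub>R y \<in> S" by (auto simp: S_def)
  qed
  have "bounded S"
  proof (rule boundedI)
    fix x assume "x \<in> S"
    then obtain \<phi> where \<phi>: "\<phi> \<in> \<Phi>" "x = (\<integral>\<omega>. \<phi> \<omega> *\<^sub>R \<xi> \<omega> \<partial>M)" by (auto simp: S_def)
    have "norm x \<le> (\<integral>\<omega>. norm (\<phi> \<omega> *\<^sub>R \<xi> \<omega>) \<partial>M)" unfolding \<phi>(2) by (rule integral_norm_bound)
    also have "\<dots> \<le> (\<integral>\<omega>. norm (\<xi> \<omega>) \<partial>M)"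
    proof (rule integral_mono)
      fix \<omega> 
      have "\<bar>\<phi> \<omega>\<bar> \<le> 1 / 2" using \<phi>(1) by (simp add: \<Phi>_def)
      then show "norm (\<phi> \<omega> *\<^sub>R \<xi> \<omega>) \<le> norm (\<xi> \<omega>)" using mult_right_mono[of "\<bar>\<phi> \<omega>\<bar>" 1 "norm (\<xi> \<omega>)"] by simp
    qed (rule integrable_norm[OF int\<phi>[OF \<phi>(1)]], rule integrable_norm[OF int])
    finally show "norm x \<le> (\<integral>\<omega>. norm (\<xi> \<omega>) \<partial>M)" .
  qed
  define Z where "Z = closure S"
  have Z: "compact Z" "convex Z" "Z \<noteq> {}"
    using \<open>bounded S\<close> \<open>convex S\<close> S_att by (auto simp: Z_def compact_closure convex_closure)
  have suppZ: "support_fun Z u = ?h u" for u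
  proof -
    obtain x where x: "x \<in> S" "u \<bullet> x = ?h u" using S_att by blast
    have "Z \<subseteq> {y. u \<bullet> y \<le> ?h u}" unfolding Z_def
      using S_le by (intro closure_minimal closed_halfspace_le) auto
    then show ?thesis using x closure_subset[of S]
      by (intro support_fun_eqI[OF Z(1,3), of x]) (auto simp: Z_def)
  qed
  have "zonoid Z" unfolding zonoid_iff
  proof (intro conjI allI impI)
    fix e :: real assume e: "e > 0"
    have "has_bochner_integral M \<xi> (\<integral>\<omega>. \<xi> \<omega> \<partial>M)" using int by (rule has_bochner_integral_integrable)
    then obtain s where s: "\<And>i. Bochner_Integration.simple_bochner_integrable M (s i)" 
       "(\<lambda>i. \<integral>\<^sup>+x. norm (\<xi> x - s i x) \<partial>M) \<longlonglongrightarrow> 0"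
      by (cases rule: has_bochner_integral.cases) auto
    have "eventually (\<lambda>i. (\<integral>\<^sup>+x. norm (\<xi> x - s i x) \<partial>M) < ennreal e) sequentially"
      using s(2) e by (intro order_tendstoD(2)[of _ 0]) auto
    then obtain i where i: "(\<integral>\<^sup>+x. norm (\<xi> x - s i x) \<partial>M) < ennreal e" by (auto simp: eventually_sequentially)
    have sf: "simple_function M (s i)" and ints: "integrable M (s i)"
      using s(1)[of i] integrable.intros[OF has_bochner_integral_simple_bochner_integrable[OF s(1)]] 
      by (auto simp: Bochner_Integration.simple_bochner_integrable.simps)
    have intd: "integrable M (\<lambda>\<omega>. norm (\<xi> \<omega> - s i \<omega>))" using int ints by simp
    have "(\<integral>\<^sup>+x. norm (\<xi> x - s i x) \<partial>M) = ennreal (\<integral>\<omega>. norm (\<xi> \<omega> - s i \<omega>) \<partial>M)"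
      by (rule nn_integral_eq_integral[OF intd]) simp
    then have le_e: "(\<integral>\<omega>. norm (\<xi> \<omega> - s i \<omega>) \<partial>M) \<le> e" using i 
      by (simp add: ennreal_less_iff)
    obtain P where P: "zonotope P" "\<And>u. support_fun P u = (\<integral>\<omega>. \<bar>u \<bullet> s i \<omega>\<bar> \<partial>M) / 2"
      using simple_zonotope[OF prob_space_axioms sf] by blast
    note P' = zonotope_convex_compact[OF P(1)]
    have diff: "\<bar>(\<integral>\<omega>. \<bar>u \<bullet> \<xi> \<omega>\<bar> \<partial>M) - (\<integral>\<omega>. \<bar>u \<bullet> s i \<omega>\<bar> \<partial>M)\<bar> \<le> e * norm u" for u
    proof -
      have i2: "integrable M (\<lambda>\<omega>. \<bar>u \<bullet> s i \<omega>\<bar>)" using ints by simp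
      have "\<bar>(\<integral>\<omega>. \<bar>u \<bullet> \<xi> \<omega>\<bar> \<partial>M) - (\<integral>\<omega>. \<bar>u \<bullet> s i \<omega>\<bar> \<partial>M)\<bar> = \<bar>\<integral>\<omega>. (\<bar>u \<bullet> \<xi> \<omega>\<bar> - \<bar>u \<bullet> s i \<omega>\<bar>) \<partial>M\<bar>"
        using intu i2 by simp
      also have "\<dots> \<le> (\<integral>\<omega>. norm u * norm (\<xi> \<omega> - s i \<omega>) \<partial>M)"
      proof (rule integral_abs_bound[THEN order_trans], rule integral_mono)
        fix \<omega>
        have "\<bar>\<bar>u \<bullet> \<xi> \<omega>\<bar> - \<bar>u \<bullet> s i \<omega>\<bar>\<bar> \<le> \<bar>u \<bullet> (\<xi> \<omega> - s i \<omega>)\<bar>" by (simp add: inner_diff_right abs_triangle_ineq3)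
        also have "\<dots> \<le> norm u * norm (\<xi> \<omega> - s i \<omega>)" by (rule Cauchy_Schwarz_ineq2)
        finally show "\<bar>\<bar>u \<bullet> \<xi> \<omega>\<bar> - \<bar>u \<bullet> s i \<omega>\<bar>\<bar> \<le> norm u * norm (\<xi> \<omega> - s i \<omega>)" .
      qed (use intu i2 intd in auto)
      also have "\<dots> \<le> e * norm u" using mult_left_mono[OF le_e norm_ge_zero[of u]] by (simp add: mult.commute)
      finally show ?thesis .
    qed
    show "\<exists>P. zonotope P \<and> P \<subseteq> (\<Union>z\<in>Z. cball z e) \<and> Z \<subseteq> (\<Union>p\<in>P. cball p e)"
    proof (intro exI[of _ P] conjI P(1) support_fun_le_imp_subset)
      fix u :: 'a
      have "0 \<le> e * norm u" using e by simp
      then show "support_fun P u \<le> support_fun Z u + e * norm u" "support_fun Z u \<le> support_fun P u + e * norm u"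
        using diff[of u] by (auto simp: P(2) suppZ)
    qed (use P' Z e in auto)
  qed (use Z in auto)
  moreover have "uminus ` Z = Z"
  proof (rule support_fun_inj)
    have lin: "linear (uminus :: 'a \<Rightarrow> 'a)" by (simp add: linear_iff)
    show "zonoid (uminus ` Z)" by (rule zonoid_linear_image[OF lin \<open>zonoid Z\<close>])
    have "adjoint (uminus :: 'a \<Rightarrow> 'a) = uminus" by (rule adjoint_unique) simp
    then show "support_fun (uminus ` Z) u = support_fun Z u" for u 
      by (simp add: support_fun_linear_image[OF lin] suppZ)
  qed fact
  ultimately show ?thesis using suppZ by blast
qed

typedef (overloaded) 'a czonoid = "{Z :: 'a::euclidean_space set. zonoid Z \<and> uminus ` Z = Z}"
  morphisms body Abs_czonoid
proof (intro exI CollectI conjI)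
  have "zonotope {0 :: 'a}" unfolding zonotope_def by (rule exI[of _ "[]"]) simp
  then show "zonoid {0 :: 'a}" by (rule zonotope_imp_zonoid)
qed simp

setup_lifting type_definition_czonoid

lemma zonoid_body: "zonoid (body K)" and centered_body: "uminus ` body K = body K"
  using body by auto

lemma compact_body: "compact (body K)" and body_nonempty: "body K \<noteq> {}"
  using zonoid_body zonoid_compact zonoid_nonempty by blast+

lemma czonoid_eqI: "(\<And>u. support_fun (body K) u = support_fun (body L) u) \<Longrightarrow> K = L"
  using support_fun_inj[OF zonoid_body zonoid_body] body_inject by blast

instantiation czonoid :: (euclidean_space) comm_monoid_add
begin

lift_definition zero_czonoid :: "'a czonoid" is "{0}"
proof -
  have "zonotope {0 :: 'a}" unfolding zonotope_def by (rule exI[of _ "[]"]) simp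
  then show "zonoid {0 :: 'a} \<and> uminus ` {0 :: 'a} = {0}" by (simp add: zonotope_imp_zonoid)
qed

lift_definition plus_czonoid :: "'a czonoid \<Rightarrow> 'a czonoid \<Rightarrow> 'a czonoid" is "(+)"
proof -
  fix A B :: "'a set"
  assume "zonoid A \<and> uminus ` A = A" "zonoid B \<and> uminus ` B = B"
  moreover have "linear (uminus :: 'a \<Rightarrow> 'a)" by (simp add: linear_iff)
  ultimately show "zonoid (A + B) \<and> uminus ` (A + B) = A + B"
    by (simp add: zonoid_add linear_image_set_plus)
qed

instance
proof
  fix A B C :: "'a czonoid"
  show "A + B + C = A + (B + C)" by transfer (rule add.assoc)
  show "A + B = B + A" by transfer (rule add.commute)
  show "0 + A = A" by transfer simp
qed

end

lemma linear_imp_centered: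
  assumes "linear f" "zonoid Z \<and> uminus ` Z = Z"
  shows "zonoid (f ` Z) \<and> uminus ` (f ` Z) = f ` Z"
proof -
  have "uminus ` (f ` Z) = f ` (uminus ` Z)" by (simp add: image_image linear_neg[OF assms(1)])
  then show ?thesis using assms by (simp add: zonoid_linear_image)
qed

lift_definition dilate :: "real \<Rightarrow> 'a::euclidean_space czonoid \<Rightarrow> 'a czonoid" is "\<lambda>c Z. (*\<^sub>R) c ` Z"
  by (rule linear_imp_centered[OF linear_scale_self])

lift_definition czonoid_image :: "real ^ 'm ^ 'n \<Rightarrow> (real ^ 'm) czonoid \<Rightarrow> (real ^ 'n) czonoid"
  is "\<lambda>A Z. (*v) A ` Z"
  by (rule linear_imp_centered) simp_all

abbreviation supp :: "'a::euclidean_space czonoid \<Rightarrow> 'a \<Rightarrow> real" where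
  "supp K \<equiv> support_fun (body K)"

lemma supp_zero: "supp 0 u = 0"
  by (simp add: zero_czonoid.rep_eq support_fun_def)

lemma supp_plus: "supp (K + L) u = supp K u + supp L u"
  by (simp add: plus_czonoid.rep_eq support_fun_add compact_body body_nonempty)

lemma supp_uminus: "supp K (- u) = supp K u"
proof -
  have lin: "linear (uminus :: 'a \<Rightarrow> 'a)" by (simp add: linear_iff)
  have "adjoint (uminus :: 'a \<Rightarrow> 'a) = uminus" by (rule adjoint_unique) simp
  then show ?thesis using support_fun_linear_image[OF lin, of "body K" u] by (simp add: centered_body)
qed

lemma supp_nonneg: "0 \<le> supp K u"
proof -
  obtain x where x: "x \<in> body K" using body_nonempty by blast
  then have "- x \<in> body K" using centered_body by blast
  then show ?thesis using support_fun_upper[OF compact_body, of x K u] support_fun_upper[OF compact_body, of "-x" K u] x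
    by simp
qed

lemma support_fun_scale:
  assumes "compact K" "K \<noteq> {}" "0 \<le> c"
  shows "support_fun K (c *\<^sub>R u) = c * support_fun K u"
proof -
  obtain x where x: "x \<in> K" "support_fun K u = u \<bullet> x" using support_fun_attained assms by blast
  show ?thesis
    using x support_fun_upper[OF assms(1), of _ u] assms(3)
    by (intro support_fun_eqI[OF assms(1,2) x(1)]) (auto intro: mult_left_mono)
qed

lemma supp_dilate: "supp (dilate c K) u = \<bar>c\<bar> * supp K u"
proof -
  have "adjoint ((*\<^sub>R) c :: 'a \<Rightarrow> 'a) = (*\<^sub>R) c" by (rule adjoint_unique) simp
  then have *: "supp (dilate c K) u = supp K (c *\<^sub>R u)"
    using support_fun_linear_image[OF linear_scale_self, of c "body K" u] by (simp add: dilate.rep_eq)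
  show ?thesis
  proof (cases "0 \<le> c")
    case True
    then show ?thesis using * by (simp add: support_fun_scale compact_body body_nonempty)
  next
    case False
    then have "supp K (c *\<^sub>R u) = supp K ((- c) *\<^sub>R u)" using supp_uminus[of K "c *\<^sub>R u"] by simp
    also have "\<dots> = (- c) * supp K u" using False
      by (intro support_fun_scale compact_body body_nonempty) simp
    finally show ?thesis using * False by simp
  qed
qed

lemma supp_czonoid_image: "supp (czonoid_image A K) u = supp K (transpose A *v u)"
proof -
  have "adjoint ((*v) A) = (*v) (transpose A)" by (rule adjoint_matrix)
  then show ?thesis
    using support_fun_linear_image[of "(*v) A" "body K" u] by (simp add: czonoid_image.rep_eq)
qed

text \<open>\<open>zonoid_of M \<xi>\<close> is the zonoid \<open>K(\<xi>)\<close> of the random vector \<open>\<xi>\<close> on the probability space \<open>M\<close>.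
  That there is exactly one such centered zonoid is \<open>exists_zonoid_of\<close> together with \<open>czonoid_eqI\<close>.\<close>

definition zonoid_of :: "'s measure \<Rightarrow> ('s \<Rightarrow> 'a::euclidean_space) \<Rightarrow> 'a czonoid" where
  "zonoid_of M \<xi> = (THE K. \<forall>u. support_fun (body K) u = (\<integral>\<omega>. \<bar>u \<bullet> \<xi> \<omega>\<bar> \<partial>M) / 2)"

lemma supp_zonoid_of:
  fixes \<xi> :: "'s \<Rightarrow> 'a::euclidean_space"
  assumes "random_vector M \<xi>"
  shows "support_fun (body (zonoid_of M \<xi>)) u = (\<integral>\<omega>. \<bar>u \<bullet> \<xi> \<omega>\<bar> \<partial>M) / 2"
proof -
  obtain Z where Z: "zonoid Z" "uminus ` Z = Z" "\<And>u. support_fun Z u = (\<integral>\<omega>. \<bar>u \<bullet> \<xi> \<omega>\<bar> \<partial>M) / 2"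
    using exists_zonoid_of[OF assms] by blast
  have "body (Abs_czonoid Z) = Z" using Z(1,2) by (simp add: Abs_czonoid_inverse)
  then have "\<forall>u. supp (Abs_czonoid Z) u = (\<integral>\<omega>. \<bar>u \<bullet> \<xi> \<omega>\<bar> \<partial>M) / 2" using Z(3) by simp
  then have "\<forall>u. supp (zonoid_of M \<xi>) u = (\<integral>\<omega>. \<bar>u \<bullet> \<xi> \<omega>\<bar> \<partial>M) / 2"
    unfolding zonoid_of_def
  proof (rule theI)
    fix K :: "'a czonoid" assume *: "\<forall>u. supp K u = (\<integral>\<omega>. \<bar>u \<bullet> \<xi> \<omega>\<bar> \<partial>M) / 2"
    show "K = Abs_czonoid Z"
      by (rule czonoid_eqI) (simp only: *[rule_format] Z(3) \<open>body (Abs_czonoid Z) = Z\<close>)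
  qed
  then show ?thesis by blast
qed

lemma random_vector_image:
  assumes "random_vector M \<xi>"
  shows "random_vector M (\<lambda>\<omega>. (A :: real ^ 'm ^ 'n) *v \<xi> \<omega>)"
  using assms integrable_bounded_linear[OF matrix_vector_mul_bounded_linear, of M \<xi> A] 
  by (simp add: random_vector_def)

lemma czonoid_image_zonoid_of:
  assumes "random_vector M \<xi>"
  shows "czonoid_image A (zonoid_of M \<xi>) = zonoid_of M (\<lambda>\<omega>. A *v \<xi> \<omega>)"
proof (rule czonoid_eqI)
  fix u
  have "\<bar>(transpose A *v u) \<bullet> \<xi> \<omega>\<bar> = \<bar>u \<bullet> (A *v \<xi> \<omega>)\<bar>" for \<omega>
    by (simp add: dot_lmul_matrix)
  then show "supp (czonoid_image A (zonoid_of M \<xi>)) u = supp (zonoid_of M (\<lambda>\<omega>. A *v \<xi> \<omega>)) u"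
    by (simp add: supp_czonoid_image supp_zonoid_of[OF assms] supp_zonoid_of[OF random_vector_image[OF assms]])
qed

text \<open>Formal differences of centered zonoids; the pair \<open>(K, L)\<close> stands for \<open>K - L\<close>.\<close>

definition same_difference :: "'a::euclidean_space czonoid \<times> 'a czonoid \<Rightarrow> 'a czonoid \<times> 'a czonoid \<Rightarrow> bool" where
  "same_difference = (\<lambda>(K, L) (K', L'). K + L' = K' + L)"

lemma same_difference_iff:
  "same_difference (K, L) (K', L') \<longleftrightarrow> (\<forall>u. supp K u - supp L u = supp K' u - supp L' u)"
proof -
  have "K + L' = K' + L \<longleftrightarrow> (\<forall>u. supp (K + L') u = supp (K' + L) u)"
    by (metis czonoid_eqI)
  then show ?thesis by (simp add: same_difference_def supp_plus algebra_simps)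
qed

quotient_type (overloaded) 'a vzonoid = "'a::euclidean_space czonoid \<times> 'a czonoid" / same_difference
  by (rule equivpI) (auto simp: reflp_def symp_def transp_def same_difference_iff)

instantiation vzonoid :: (euclidean_space) real_vector
begin

lift_definition zero_vzonoid :: "'a vzonoid" is "(0, 0)" .

lift_definition plus_vzonoid :: "'a vzonoid \<Rightarrow> 'a vzonoid \<Rightarrow> 'a vzonoid"
  is "\<lambda>(K, L) (K', L'). (K + K', L + L')"
  by (auto simp: same_difference_iff supp_plus algebra_simps)

lift_definition uminus_vzonoid :: "'a vzonoid \<Rightarrow> 'a vzonoid" is "\<lambda>(K, L). (L, K)"
  by (auto simp: same_difference_iff algebra_simps)

definition minus_vzonoid :: "'a vzonoid \<Rightarrow> 'a vzonoid \<Rightarrow> 'a vzonoid" where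
  "X - Y = X + - (Y :: 'a vzonoid)"

text \<open>Since \<open>dilate c K = dilate \<bar>c\<bar> K\<close> for a centered \<open>K\<close>, a negative scalar
  has to exchange the two components.\<close>

lift_definition scaleR_vzonoid :: "real \<Rightarrow> 'a vzonoid \<Rightarrow> 'a vzonoid"
  is "\<lambda>c (K, L). if 0 \<le> c then (dilate c K, dilate c L) else (dilate c L, dilate c K)"
  by (auto simp: same_difference_iff supp_dilate simp flip: right_diff_distrib)

instance
proof
  fix X Y Z :: "'a vzonoid" and a b :: real
  show "X + Y + Z = X + (Y + Z)" by transfer (auto simp: same_difference_iff supp_plus)
  show "X + Y = Y + X" by transfer (auto simp: same_difference_iff supp_plus)
  show "0 + X = X" by transfer (auto simp: same_difference_iff supp_plus)
  show "- X + X = 0" by transfer (auto simp: same_difference_iff supp_plus supp_zero)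
  show "X - Y = X + - Y" by (simp add: minus_vzonoid_def)
  show "a *\<^sub>R (X + Y) = a *\<^sub>R X + a *\<^sub>R Y"
    by transfer (auto simp: same_difference_iff supp_plus supp_dilate algebra_simps)
  show "(a + b) *\<^sub>R X = a *\<^sub>R X + b *\<^sub>R X"
    by transfer (auto simp: same_difference_iff supp_plus supp_dilate algebra_simps abs_if split: if_splits)
  show "a *\<^sub>R b *\<^sub>R X = (a * b) *\<^sub>R X"
    by transfer (auto simp: same_difference_iff supp_plus supp_dilate abs_mult zero_le_mult_iff algebra_simps)
  show "1 *\<^sub>R X = X" by transfer (auto simp: same_difference_iff supp_dilate)
qed

end

text \<open>The class of the centered zonoid \<open>K\<close>, i.e. \<open>K - 0\<close>.\<close>

definition virtual :: "'a::euclidean_space czonoid \<Rightarrow> 'a vzonoid" where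
  "virtual K = abs_vzonoid (K, 0)"

lift_definition vzonoid_image :: "real ^ 'm ^ 'n \<Rightarrow> (real ^ 'm) vzonoid \<Rightarrow> (real ^ 'n) vzonoid"
  is "\<lambda>A (K, L). (czonoid_image A K, czonoid_image A L)"
  by (auto simp: same_difference_iff supp_czonoid_image)

lemma vzonoid_image_virtual: "vzonoid_image A (virtual K) = virtual (czonoid_image A K)"
  by (simp add: virtual_def vzonoid_image.abs_eq vzonoid.abs_eq_iff same_difference_iff supp_czonoid_image supp_zero)

lemma linear_vzonoid_image: "linear (vzonoid_image A)"
proof (rule linearI)
  show "vzonoid_image A (X + Y) = vzonoid_image A X + vzonoid_image A Y" for X Y
    by transfer (auto simp: same_difference_iff supp_plus supp_czonoid_image)
  show "vzonoid_image A (c *\<^sub>R X) = c *\<^sub>R vzonoid_image A X" for c X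
    by transfer (auto simp: same_difference_iff supp_dilate supp_czonoid_image)
qed

lift_definition vsupp :: "'a::euclidean_space vzonoid \<Rightarrow> 'a \<Rightarrow> real" is "\<lambda>(K, L) u. supp K u - supp L u"
  by (auto simp: same_difference_iff)

lemma vsupp_virtual: "vsupp (virtual K) u = supp K u"
  by (simp add: virtual_def vsupp.abs_eq supp_zero)

lemma vsupp_add: "vsupp (X + Y) u = vsupp X u + vsupp Y u"
  by transfer (auto simp: supp_plus)

lemma vsupp_scaleR: "vsupp (c *\<^sub>R X) u = c * vsupp X u"
  by transfer (auto simp: supp_dilate algebra_simps)

lemma continuous_supp: "continuous_on UNIV (supp (K :: 'a::euclidean_space czonoid))"
proof -
  obtain C where C: "\<And>x. x \<in> body K \<Longrightarrow> norm x \<le> C" "C > 0" 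
    using compact_imp_bounded[OF compact_body, of K] unfolding bounded_pos by blast
  have *: "supp K u \<le> supp K v + C * norm (u - v)" for u v
  proof -
    obtain x where x: "x \<in> body K" "supp K u = u \<bullet> x" using support_fun_attained[OF compact_body body_nonempty] by blast
    have "u \<bullet> x = v \<bullet> x + (u - v) \<bullet> x" by (simp add: inner_diff_left)
    also have "\<dots> \<le> supp K v + norm (u - v) * norm x"
      using support_fun_upper[OF compact_body x(1), of v] norm_cauchy_schwarz[of "u - v" x] by linarith
    also have "\<dots> \<le> supp K v + norm (u - v) * C" using C(1)[OF x(1)] by (intro add_left_mono mult_left_mono) auto
    finally show ?thesis using x by (simp add: mult.commute)
  qed
  have "C-lipschitz_on UNIV (supp K)"
  proof (rule lipschitz_onI)
    fix u v :: 'a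
    show "dist (supp K u) (supp K v) \<le> C * dist u v"
      using *[of u v] *[of v u] by (simp add: dist_real_def dist_norm norm_minus_commute abs_le_iff)
  qed (use C in simp)
  then show ?thesis by (rule lipschitz_on_continuous_on)
qed

lemma supp_bound: "\<exists>C\<ge>0. \<forall>u. \<bar>supp K u\<bar> \<le> C * norm u"
proof -
  obtain C where C: "\<And>x. x \<in> body K \<Longrightarrow> norm x \<le> C" "C > 0" 
    using compact_imp_bounded[OF compact_body, of K] unfolding bounded_pos by blast
  have "\<bar>supp K u\<bar> \<le> C * norm u" for u
  proof -
    obtain x where x: "x \<in> body K" "supp K u = u \<bullet> x" using support_fun_attained[OF compact_body body_nonempty] by blast
    have "supp K u \<le> norm u * norm x" using x norm_cauchy_schwarz[of u x] by simp
    also have "\<dots> \<le> norm u * C" using C(1)[OF x(1)] by (intro mult_left_mono) auto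
    finally show ?thesis using supp_nonneg[of K u] by (simp add: mult.commute)
  qed
  then show ?thesis using C(2) by (intro exI[of _ C]) simp
qed

lemma integrable_supp:
  assumes "random_vector M \<xi>" shows "integrable M (\<lambda>\<omega>. supp K (\<xi> \<omega>))"
proof -
  have int: "integrable M \<xi>" using assms by (simp add: random_vector_def)
  note [measurable] = borel_measurable_integrable[OF int]
  have [measurable]: "supp K \<in> borel_measurable borel" using continuous_supp by (rule borel_measurable_continuous_onI)
  obtain C where C: "0 \<le> C" "\<And>u. \<bar>supp K u\<bar> \<le> C * norm u" using supp_bound by blast
  have "integrable M (\<lambda>\<omega>. C * norm (\<xi> \<omega>))" using int by simp
  then show ?thesis
  proof (rule Bochner_Integration.integrable_bound)
    show "(\<lambda>\<omega>. supp K (\<xi> \<omega>)) \<in> borel_measurable M" by measurable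
    show "AE \<omega> in M. norm (supp K (\<xi> \<omega>)) \<le> norm (C * norm (\<xi> \<omega>))"
      using C by simp
  qed
qed

lemma integrable_vsupp:
  assumes "random_vector M \<xi>" shows "integrable M (\<lambda>\<omega>. vsupp X (\<xi> \<omega>))"
proof -
  obtain K L where "rep_vzonoid X = (K, L)" by (rule prod.exhaust)
  then have "vsupp X u = supp K u - supp L u" for u by (simp add: vsupp.rep_eq)
  then show ?thesis using integrable_supp[OF assms] by simp
qed

lemma product_integral:
  assumes \<xi>: "random_vector M \<xi>" and \<zeta>: "random_vector N \<zeta>"
  shows "(\<integral>x. (\<integral>y. \<bar>\<xi> x \<bullet> \<zeta> y\<bar> \<partial>N) \<partial>M) = (\<integral>z. \<bar>\<xi> (fst z) \<bullet> \<zeta> (snd z)\<bar> \<partial>(M \<Otimes>\<^sub>M N))"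
    and "(\<integral>y. (\<integral>x. \<bar>\<xi> x \<bullet> \<zeta> y\<bar> \<partial>M) \<partial>N) = (\<integral>z. \<bar>\<xi> (fst z) \<bullet> \<zeta> (snd z)\<bar> \<partial>(M \<Otimes>\<^sub>M N))"
proof -
  interpret M: prob_space M using \<xi> by (simp add: random_vector_def)
  interpret N: prob_space N using \<zeta> by (simp add: random_vector_def)
  interpret pair_sigma_finite M N ..
  have int: "integrable M \<xi>" "integrable N \<zeta>" using \<xi> \<zeta> by (auto simp: random_vector_def)
  note [measurable] = borel_measurable_integrable[OF int(1)] borel_measurable_integrable[OF int(2)]
  have "integrable (M \<Otimes>\<^sub>M N) (\<lambda>z. norm (\<xi> (fst z)) * norm (\<zeta> (snd z)))"
  proof (rule Fubini_integrable)
    show "integrable M (\<lambda>x. \<integral>y. norm (norm (\<xi> (fst (x, y))) * norm (\<zeta> (snd (x, y)))) \<partial>N)"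
      using int by (simp add: abs_mult)
    show "AE x in M. integrable N (\<lambda>y. norm (\<xi> (fst (x, y))) * norm (\<zeta> (snd (x, y))))"
      using int by simp
  qed measurable
  then have "integrable (M \<Otimes>\<^sub>M N) (\<lambda>z. \<bar>\<xi> (fst z) \<bullet> \<zeta> (snd z)\<bar>)"
  proof (rule Bochner_Integration.integrable_bound)
    show "AE z in M \<Otimes>\<^sub>M N. norm \<bar>\<xi> (fst z) \<bullet> \<zeta> (snd z)\<bar> \<le> norm (norm (\<xi> (fst z)) * norm (\<zeta> (snd z)))"
      by (simp add: Cauchy_Schwarz_ineq2)
  qed measurable
  then have int2: "integrable (M \<Otimes>\<^sub>M N) (case_prod (\<lambda>x y. \<bar>\<xi> x \<bullet> \<zeta> y\<bar>))" by (simp add: case_prod_unfold)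
  from integral_fst[OF int2] integral_snd[OF int2]
  show "(\<integral>x. (\<integral>y. \<bar>\<xi> x \<bullet> \<zeta> y\<bar> \<partial>N) \<partial>M) = (\<integral>z. \<bar>\<xi> (fst z) \<bullet> \<zeta> (snd z)\<bar> \<partial>(M \<Otimes>\<^sub>M N))"
    and "(\<integral>y. (\<integral>x. \<bar>\<xi> x \<bullet> \<zeta> y\<bar> \<partial>M) \<partial>N) = (\<integral>z. \<bar>\<xi> (fst z) \<bullet> \<zeta> (snd z)\<bar> \<partial>(M \<Otimes>\<^sub>M N))"
    by (simp_all add: case_prod_unfold)
qed

text \<open>Independent vectors \<open>\<xi>\<close>, \<open>\<zeta>\<close> are realised on the product of their probability spaces. As \<open>K(\<xi>)\<close>
  depends only on the law of \<open>\<xi>\<close>, it is enough to let the sample space be \<open>'a\<close> itself.\<close>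

definition is_zonoid_pairing :: "('a::euclidean_space vzonoid \<Rightarrow> 'a vzonoid \<Rightarrow> real) \<Rightarrow> bool" where
  "is_zonoid_pairing b \<longleftrightarrow> bilinear b \<and>
     (\<forall>(M :: 'a measure) (N :: 'a measure) \<xi> \<zeta>. random_vector M \<xi> \<longrightarrow> random_vector N \<zeta> \<longrightarrow>
        b (virtual (zonoid_of M \<xi>)) (virtual (zonoid_of N \<zeta>)) =
          (\<integral>z. \<bar>\<xi> (fst z) \<bullet> \<zeta> (snd z)\<bar> \<partial>(M \<Otimes>\<^sub>M N)))"

text \<open>Two such pairings agree on the span of the \<open>K(\<xi>)\<close>, where alone the pairing is used below;
  existence is \<open>exists_zonoid_pairing\<close>.\<close>

definition zonoid_pairing :: "'a::euclidean_space vzonoid \<Rightarrow> 'a vzonoid \<Rightarrow> real" where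
  "zonoid_pairing = (SOME b. is_zonoid_pairing b)"

lemma exists_zonoid_pairing: "\<exists>b :: 'a::euclidean_space vzonoid \<Rightarrow> 'a vzonoid \<Rightarrow> real. is_zonoid_pairing b"
proof -
  define S :: "'a vzonoid set" where
    "S = {virtual (zonoid_of M \<xi>) |(M :: 'a measure) \<xi>. random_vector M \<xi>}"
  define F where "F = (\<lambda>(M :: 'a measure) (\<xi> :: 'a \<Rightarrow> 'a) X. 2 * (\<integral>\<omega>. vsupp X (\<xi> \<omega>) \<partial>M))"
  have linF: "linear (F M \<xi>)" if "random_vector M \<xi>" for M \<xi>
    using integrable_vsupp[OF that]
    by (intro linearI) (simp_all add: F_def vsupp_add vsupp_scaleR distrib_left)
  have F: "F M \<xi> (virtual (zonoid_of N \<zeta>)) = (\<integral>z. \<bar>\<xi> (fst z) \<bullet> \<zeta> (snd z)\<bar> \<partial>(M \<Otimes>\<^sub>M N))"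
    if "random_vector M \<xi>" "random_vector N \<zeta>" for M \<xi> N \<zeta>
    using product_integral(1)[OF that] by (simp add: F_def vsupp_virtual supp_zonoid_of[OF that(2)])
  have F_sym: "F M \<xi> (virtual (zonoid_of N \<zeta>)) = F N \<zeta> (virtual (zonoid_of M \<xi>))"
    if "random_vector M \<xi>" "random_vector N \<zeta>" for M \<xi> N \<zeta>
  proof -
    have "F N \<zeta> (virtual (zonoid_of M \<xi>)) = (\<integral>y. (\<integral>x. \<bar>\<xi> x \<bullet> \<zeta> y\<bar> \<partial>M) \<partial>N)"
      by (simp add: F_def vsupp_virtual supp_zonoid_of[OF that(1)] inner_commute)
    then show ?thesis using F[OF that] product_integral(2)[OF that] by simp
  qed
  obtain B where B: "B \<subseteq> S" "independent B" "S \<subseteq> span B" using maximal_independent_subset by blast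
  have "\<forall>v\<in>B. \<exists>p. random_vector (fst p) (snd p) \<and> v = virtual (zonoid_of (fst p :: 'a measure) (snd p))"
    using B(1) unfolding S_def by fastforce
  then obtain p where p: "\<And>v. v \<in> B \<Longrightarrow> random_vector (fst (p v)) (snd (p v))"
    "\<And>v. v \<in> B \<Longrightarrow> v = virtual (zonoid_of (fst (p v) :: 'a measure) (snd (p v)))" by metis
  define E where "E = extend_basis B"
  have E: "B \<subseteq> E" "independent E" "span E = UNIV"
    using extend_basis_superset[OF B(2)] independent_extend_basis[OF B(2)] span_extend_basis[OF B(2)] 
    by (auto simp: E_def)
  define f where "f = (\<lambda>X v. if v \<in> B then F (fst (p v)) (snd (p v)) X else 0)"
  define b where "b = (\<lambda>X. construct E (f X))"
  have lin_b: "linear (b X)" for X unfolding b_def by (rule linear_construct[OF E(2)])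
  have b_basis: "b X v = f X v" if "v \<in> E" for X v unfolding b_def using construct_basis[OF E(2) that] .
  have linf: "linear (\<lambda>X. f X v)" for v
    unfolding f_def using linF[OF p(1)] by (cases "v \<in> B") (simp_all add: module_hom_zero)
  have "bilinear b" unfolding bilinear_def
  proof (intro conjI allI)
    show "linear (\<lambda>y. b x y)" for x by (rule lin_b)
    show "linear (\<lambda>x. b x y)" for y
    proof (rule linearI)
      have y: "y \<in> span E" by (simp add: E(3))
      fix X X'
      have "linear (\<lambda>y. b X y + b X' y)" by (intro linear_compose_add lin_b)
      then show "b (X + X') y = b X y + b X' y"
        by (rule linear_eq_on[OF lin_b _ y]) (simp add: b_basis linear_add[OF linf])
    next
      fix c X
      have y: "y \<in> span E" by (simp add: E(3))
      have "linear (\<lambda>y. c *\<^sub>R b X y)" by (intro linear_compose_scale_right lin_b)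
      then show "b (c *\<^sub>R X) y = c *\<^sub>R b X y"
        by (rule linear_eq_on[OF lin_b _ y]) (simp add: b_basis linear_scale[OF linf])
    qed
  qed
  moreover have "b (virtual (zonoid_of M \<xi>)) (virtual (zonoid_of N \<zeta>)) =
          (\<integral>z. \<bar>\<xi> (fst z) \<bullet> \<zeta> (snd z)\<bar> \<partial>(M \<Otimes>\<^sub>M N))"
    if rv: "random_vector M \<xi>" "random_vector N \<zeta>" for M N :: "'a measure" and \<xi> \<zeta>
  proof -
    have "virtual (zonoid_of N \<zeta>) \<in> S" using rv by (auto simp: S_def)
    then have "virtual (zonoid_of N \<zeta>) \<in> span B" using B(3) by blast
    then have "b (virtual (zonoid_of M \<xi>)) (virtual (zonoid_of N \<zeta>)) = F M \<xi> (virtual (zonoid_of N \<zeta>))"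
    proof (rule linear_eq_on[OF lin_b linF[OF rv(1)]])
      fix v assume v: "v \<in> B"
      have "b (virtual (zonoid_of M \<xi>)) v = F (fst (p v)) (snd (p v)) (virtual (zonoid_of M \<xi>))"
        using v E(1) by (subst b_basis) (auto simp: f_def)
      also have "\<dots> = F M \<xi> (virtual (zonoid_of (fst (p v)) (snd (p v))))"
        by (rule F_sym[OF p(1)[OF v] rv(1)])
      finally show "b (virtual (zonoid_of M \<xi>)) v = F M \<xi> v" using p(2)[OF v] by simp
    qed
    then show ?thesis using F[OF rv] by simp
  qed
  ultimately show ?thesis unfolding is_zonoid_pairing_def by blast
qed

lemma is_zonoid_pairing: "is_zonoid_pairing zonoid_pairing"
  unfolding zonoid_pairing_def by (rule someI_ex[OF exists_zonoid_pairing])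

text \<open>
  The exterior algebra of \<open>V = real ^ 'n\<close> is \<open>real ^ ('n set)\<close>, with the coordinate at
  \<open>S = {s\<^sub>1, \<dots>, s\<^sub>d}\<close> belonging to \<open>e\<^sub>s\<^sub>1 \<and> \<dots> \<and> e\<^sub>s\<^sub>d\<close>; the elements of \<open>S\<close> are listed in a fixed but
  arbitrary order. The vectors supported on the sets of cardinality \<open>d\<close> form the \<open>d\<close>-th exterior
  power. The standard inner product induces on it the inner product with
  \<open>\<langle>v\<^sub>1 \<and> \<dots> \<and> v\<^sub>d, w\<^sub>1 \<and> \<dots> \<and> w\<^sub>d\<rangle> = det \<langle>v\<^sub>i, w\<^sub>j\<rangle>\<close>, see \<open>inner_wedge\<close>.
\<close>

text \<open>The determinant of the \<open>d \<times> d\<close> matrix \<open>M\<close>, where \<open>d\<close> is not encoded in a type.\<close>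

definition minor_det :: "nat \<Rightarrow> (nat \<Rightarrow> nat \<Rightarrow> real) \<Rightarrow> real" where
  "minor_det d M = (\<Sum>p | p permutes {..<d}. of_int (sign p) * (\<Prod>i<d. M i (p i)))"

definition enum_set :: "'n::finite set \<Rightarrow> 'n list" where
  "enum_set S = map from_nat (sorted_list_of_set (to_nat ` S))"

lemma enum_set:
  fixes S :: "'n::finite set"
  shows "distinct (enum_set S)" "set (enum_set S) = S" "length (enum_set S) = card S"
proof -
  have "inj_on (from_nat :: nat \<Rightarrow> 'n) (to_nat ` S)" by (rule inj_onI) auto
  then show "distinct (enum_set S)" by (simp add: enum_set_def distinct_map)
  show "set (enum_set S) = S" by (simp add: enum_set_def image_image)
  then show "length (enum_set S) = card S" using \<open>distinct (enum_set S)\<close> distinct_card by metis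
qed

definition wedge :: "(real ^ 'n) list \<Rightarrow> real ^ ('n::finite set)" where
  "wedge vs = (\<chi> S. if card S = length vs
     then minor_det (length vs) (\<lambda>i j. vs ! i $ (enum_set S ! j)) else 0)"

text \<open>For \<open>d = 0\<close> the only such vector is the empty product \<open>1\<close>. Admitting all scalars would not
  change the span of the \<open>K(\<xi>)\<close> in degree \<open>0\<close>, which consists of the multiples of one segment.\<close>

definition simple_multivector :: "nat \<Rightarrow> real ^ ('n::finite set) \<Rightarrow> bool" where
  "simple_multivector d x \<longleftrightarrow> (\<exists>vs. length vs = d \<and> x = wedge vs)"

text \<open>The endomorphism induced on the exterior algebra by the endomorphism \<open>A\<close> of \<open>V\<close>, that is,
  \<open>v\<^sub>1 \<and> \<dots> \<and> v\<^sub>d \<mapsto> A v\<^sub>1 \<and> \<dots> \<and> A v\<^sub>d\<close>, see \<open>exterior_power_wedge\<close>.\<close>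

definition exterior_power :: "real ^ 'n ^ 'n \<Rightarrow> real ^ ('n::finite set) ^ ('n set)" where
  "exterior_power A = (\<chi> S T. wedge (map (\<lambda>t. column t A) (enum_set T)) $ S)"

lemma minor_det_cong:
  assumes "\<And>i j. i < d \<Longrightarrow> j < d \<Longrightarrow> M i j = N i j"
  shows "minor_det d M = minor_det d N"
  unfolding minor_det_def
proof (intro sum.cong refl arg_cong2[where f="(*)"] prod.cong)
  fix p i assume "p \<in> {p. p permutes {..<d}}" "i \<in> {..<d}"
  then show "M i (p i) = N i (p i)" using permutes_in_image[of p "{..<d}" i] assms by auto
qed

lemma minor_det_permute_rows:
  assumes q: "q permutes {..<d}"
  shows "minor_det d (\<lambda>i j. M (q i) j) = of_int (sign q) * minor_det d M"
proof -
  have "minor_det d (\<lambda>i j. M (q i) j) = 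
      (\<Sum>p | p permutes {..<d}. of_int (sign (p \<circ> q)) * (\<Prod>i<d. M (q i) ((p \<circ> q) i)))"
    unfolding minor_det_def by (rule sum_permutations_compose_right[OF q])
  also have "\<dots> = (\<Sum>p | p permutes {..<d}. of_int (sign q) * (of_int (sign p) * (\<Prod>i<d. M i (p i))))"
  proof (rule sum.cong[OF refl])
    fix p assume "p \<in> {p. p permutes {..<d}}"
    then have p: "p permutes {..<d}" by simp
    have "sign (p \<circ> q) = sign p * sign q"
      by (rule sign_compose[OF permutes_imp_permutation[OF _ p] permutes_imp_permutation[OF _ q]]) simp_all
    moreover have "(\<Prod>i<d. M (q i) ((p \<circ> q) i)) = (\<Prod>i<d. M i (p i))"
      using prod.permute[OF q, of "\<lambda>i. M i (p i)"] by (simp add: comp_def)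
    ultimately show "of_int (sign (p \<circ> q)) * (\<Prod>i<d. M (q i) ((p \<circ> q) i)) =
        of_int (sign q) * (of_int (sign p) * (\<Prod>i<d. M i (p i)))" by simp
  qed
  finally show ?thesis by (simp add: minor_det_def sum_distrib_left)
qed

lemma minor_det_transpose: "minor_det d (\<lambda>i j. M j i) = minor_det d M"
proof -
  have "minor_det d (\<lambda>i j. M j i) = 
      (\<Sum>p | p permutes {..<d}. of_int (sign (inv p)) * (\<Prod>i<d. M (inv p i) i))"
    unfolding minor_det_def by (rule sum_permutations_inverse)
  also have "\<dots> = minor_det d M" unfolding minor_det_def
  proof (rule sum.cong[OF refl])
    fix p assume "p \<in> {p. p permutes {..<d}}"
    then have p: "p permutes {..<d}" by simp
    have "sign (inv p) = sign p"
      by (rule sign_inverse[OF permutes_imp_permutation[OF _ p]]) simp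
    moreover have "(\<Prod>i<d. M (inv p i) i) = (\<Prod>i<d. M i (p i))"
      using prod.permute[OF p, of "\<lambda>i. M (inv p i) i"] permutes_inverses(2)[OF p] by (simp add: comp_def)
    ultimately show "of_int (sign (inv p)) * (\<Prod>i<d. M (inv p i) i) = of_int (sign p) * (\<Prod>i<d. M i (p i))"
      by simp
  qed
  finally show ?thesis .
qed

lemma minor_det_identical_rows:
  assumes "i < d" "j < d" "i \<noteq> j" "\<And>k. k < d \<Longrightarrow> M i k = M j k"
  shows "minor_det d M = 0"
proof -
  have q: "Transposition.transpose i j permutes {..<d}" using assms by (intro permutes_swap_id) auto
  have "minor_det d (\<lambda>a b. M (Transposition.transpose i j a) b) = minor_det d M"
    by (rule minor_det_cong) (auto simp: Transposition.transpose_def assms(4))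
  then show ?thesis using minor_det_permute_rows[OF q, of M] assms(3) by (simp add: sign_swap_id)
qed

lemma cauchy_binet:
  fixes M :: "nat \<Rightarrow> 'n::finite \<Rightarrow> real" and K :: "'n \<Rightarrow> nat \<Rightarrow> real"
  shows "minor_det d (\<lambda>i j. \<Sum>n\<in>UNIV. M i n * K n j) =
    (\<Sum>T | card T = d. minor_det d (\<lambda>i j. M i (enum_set T ! j)) * minor_det d (\<lambda>i j. K (enum_set T ! i) j))"
proof -
  let ?P = "{p. p permutes {..<d}}"
  let ?E = "PiE {..<d} (\<lambda>_. UNIV :: 'n set)"
  let ?g = "\<lambda>f. (\<Prod>i<d. M i (f i)) * minor_det d (\<lambda>i j. K (f i) j)"
  have finE: "finite ?E" by (intro finite_PiE) auto
  have finP: "finite ?P" by (rule finite_permutations) simp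
  have "minor_det d (\<lambda>i j. \<Sum>n\<in>UNIV. M i n * K n j) =
     (\<Sum>p\<in>?P. of_int (sign p) * (\<Sum>f\<in>?E. \<Prod>i<d. M i (f i) * K (f i) (p i)))"
    unfolding minor_det_def by (subst prod_sum_PiE) auto
  also have "\<dots> = (\<Sum>p\<in>?P. \<Sum>f\<in>?E. (\<Prod>i<d. M i (f i)) * (of_int (sign p) * (\<Prod>i<d. K (f i) (p i))))"
    by (simp add: sum_distrib_left prod.distrib mult.left_commute)
  also have "\<dots> = (\<Sum>f\<in>?E. ?g f)"
    unfolding minor_det_def by (subst sum.swap) (simp add: sum_distrib_left)
  also have "\<dots> = (\<Sum>f\<in>{f\<in>?E. inj_on f {..<d}}. ?g f)"
  proof (rule sum.mono_neutral_right[OF finE])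
    show "\<forall>f\<in>?E - {f\<in>?E. inj_on f {..<d}}. ?g f = 0"
    proof
      fix f assume "f \<in> ?E - {f\<in>?E. inj_on f {..<d}}"
      then obtain i j where "i < d" "j < d" "i \<noteq> j" "f i = f j" by (auto simp: inj_on_def)
      then have "minor_det d (\<lambda>i j. K (f i) j) = 0" by (intro minor_det_identical_rows[of i d j]) auto
      then show "?g f = 0" by simp
    qed
  qed auto
  also have "\<dots> = (\<Sum>z\<in>{T. card T = d} \<times> ?P. ?g (restrict (\<lambda>i. enum_set (fst z) ! (snd z) i) {..<d}))"
  proof (rule sum.reindex_bij_betw[symmetric])
    show "bij_betw (\<lambda>z. restrict (\<lambda>i. enum_set (fst z) ! (snd z) i) {..<d}) ({T :: 'n set. card T = d} \<times> ?P) {f\<in>?E. inj_on f {..<d}}"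
    proof (rule bij_betw_imageI)
      have img: "restrict (\<lambda>i. enum_set T ! q i) {..<d} ` {..<d} = T" if T: "card T = d" and q: "q permutes {..<d}" for T :: "'n set" and q
      proof -
        have "restrict (\<lambda>i. enum_set T ! q i) {..<d} ` {..<d} = (\<lambda>i. enum_set T ! i) ` (q ` {..<d})" by auto
        also have "\<dots> = set (enum_set T)" 
          unfolding permutes_image[OF q] by (auto simp: set_conv_nth enum_set(3) T)
        finally show ?thesis by (simp add: enum_set(2))
      qed
      show "inj_on (\<lambda>z. restrict (\<lambda>i. enum_set (fst z) ! (snd z) i) {..<d}) ({T :: 'n set. card T = d} \<times> ?P)"
      proof (rule inj_onI)
        fix z z' assume z: "z \<in> {T :: 'n set. card T = d} \<times> ?P" and z': "z' \<in> {T. card T = d} \<times> ?P"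
          and eq: "restrict (\<lambda>i. enum_set (fst z) ! (snd z) i) {..<d} = restrict (\<lambda>i. enum_set (fst z') ! (snd z') i) {..<d}"
        obtain T q where [simp]: "z = (T, q)" by force
        obtain T' q' where [simp]: "z' = (T', q')" by force
        have Tq: "card T = d" "q permutes {..<d}" "card T' = d" "q' permutes {..<d}" using z z' by auto
        have eq': "restrict (\<lambda>i. enum_set T ! q i) {..<d} = restrict (\<lambda>i. enum_set T' ! q' i) {..<d}"
          using eq by simp
        have "T = T'" using img[OF Tq(1,2)] img[OF Tq(3,4)] unfolding eq' by (rule trans[OF sym])
        have "q i = q' i" for i
        proof (cases "i < d")
          case True
          then have "enum_set T ! q i = enum_set T ! q' i" 
            using fun_cong[OF eq, of i] \<open>T = T'\<close> by simp
          moreover have "q i < d" "q' i < d" using True permutes_in_image[OF Tq(2), of i] permutes_in_image[OF Tq(4), of i] by auto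
          ultimately show ?thesis using nth_eq_iff_index_eq[OF enum_set(1)[of T]] by (simp add: enum_set(3) Tq(1))
        next
          case False
          then show ?thesis using permutes_not_in[OF Tq(2)] permutes_not_in[OF Tq(4)] by simp
        qed
        then show "z = z'" using \<open>T = T'\<close> by auto
      qed
      show "(\<lambda>z. restrict (\<lambda>i. enum_set (fst z) ! (snd z) i) {..<d}) ` ({T :: 'n set. card T = d} \<times> ?P) = {f\<in>?E. inj_on f {..<d}}"
      proof (intro equalityI subsetI)
        fix f assume "f \<in> (\<lambda>z. restrict (\<lambda>i. enum_set (fst z) ! (snd z) i) {..<d}) ` ({T :: 'n set. card T = d} \<times> ?P)"
        then obtain T q where f: "card T = d" "q permutes {..<d}" "f = restrict (\<lambda>i. enum_set T ! q i) {..<d}" by auto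
        have "card (f ` {..<d}) = card {..<d}" using img[OF f(1,2)] f by simp
        then have "inj_on f {..<d}" by (intro eq_card_imp_inj_on) auto
        then show "f \<in> {f\<in>?E. inj_on f {..<d}}" using f by auto
      next
        fix f assume f: "f \<in> {f\<in>?E. inj_on f {..<d}}"
        define T where "T = f ` {..<d}"
        have T: "card T = d" using f by (simp add: T_def card_image)
        have b: "bij_betw (\<lambda>i. enum_set T ! i) {..<d} T"
          using bij_betw_nth[OF enum_set(1)[of T], of "{..<d}" T] by (simp add: enum_set(2,3) T)
        define q where "q = (\<lambda>i. if i < d then the_inv_into {..<d} (\<lambda>i. enum_set T ! i) (f i) else i)"
        have "bij_betw f {..<d} T" using f by (auto simp: bij_betw_def T_def)
        from bij_betw_trans[OF this bij_betw_the_inv_into[OF b]]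
        have "bij_betw q {..<d} {..<d}" by (rule bij_betw_cong[THEN iffD1, rotated]) (simp add: q_def)
        then have q: "q permutes {..<d}" by (rule bij_imp_permutes) (simp add: q_def)
        have "enum_set T ! q i = f i" if "i < d" for i
          using f_the_inv_into_f_bij_betw[OF b, of "f i"] that by (auto simp: q_def T_def)
        then have "f = restrict (\<lambda>i. enum_set T ! q i) {..<d}" using f by (auto simp: fun_eq_iff PiE_def extensional_def)
        then show "f \<in> (\<lambda>z. restrict (\<lambda>i. enum_set (fst z) ! (snd z) i) {..<d}) ` ({T :: 'n set. card T = d} \<times> ?P)"
          using T q by (intro image_eqI[of _ _ "(T, q)"]) auto
      qed
    qed
  qed
  also have "\<dots> = (\<Sum>T | card T = d. \<Sum>q\<in>?P. ?g (restrict (\<lambda>i. enum_set T ! q i) {..<d}))"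
    by (simp add: sum.cartesian_product case_prod_unfold)
  also have "\<dots> = (\<Sum>T | card T = d. minor_det d (\<lambda>i j. M i (enum_set T ! j)) * minor_det d (\<lambda>i j. K (enum_set T ! i) j))"
  proof (rule sum.cong[OF refl])
    fix T :: "'n set" assume "T \<in> {T. card T = d}"
    have "?g (restrict (\<lambda>i. enum_set T ! q i) {..<d}) = 
        of_int (sign q) * (\<Prod>i<d. M i (enum_set T ! q i)) * minor_det d (\<lambda>i j. K (enum_set T ! i) j)" if q: "q \<in> ?P" for q
    proof -
      have "minor_det d (\<lambda>i j. K (restrict (\<lambda>i. enum_set T ! q i) {..<d} i) j) = minor_det d (\<lambda>i j. K (enum_set T ! (q i)) j)"
        by (rule minor_det_cong) simp
      also have "\<dots> = of_int (sign q) * minor_det d (\<lambda>i j. K (enum_set T ! i) j)"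
        using minor_det_permute_rows[of q d "\<lambda>i j. K (enum_set T ! i) j"] q by simp
      finally show ?thesis by simp
    qed
    then show "(\<Sum>q\<in>?P. ?g (restrict (\<lambda>i. enum_set T ! q i) {..<d})) = 
       minor_det d (\<lambda>i j. M i (enum_set T ! j)) * minor_det d (\<lambda>i j. K (enum_set T ! i) j)"
      unfolding minor_det_def[of d "\<lambda>i j. M i (enum_set T ! j)"] sum_distrib_right
      by (rule sum.cong[OF refl])
  qed
  finally show ?thesis .
qed

lemma inner_wedge:
  assumes "length vs = d" "length ws = d"
  shows "wedge vs \<bullet> wedge ws = minor_det d (\<lambda>i j. vs ! i \<bullet> ws ! j)"
proof -
  have "wedge vs \<bullet> wedge ws = (\<Sum>T\<in>UNIV. if card T = d then minor_det d (\<lambda>i j. vs ! i $ (enum_set T ! j)) *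
     minor_det d (\<lambda>i j. ws ! i $ (enum_set T ! j)) else 0)"
    unfolding inner_vec_def by (intro sum.cong) (auto simp: wedge_def assms)
  also have "\<dots> = (\<Sum>T | card T = d. minor_det d (\<lambda>i j. vs ! i $ (enum_set T ! j)) *
     minor_det d (\<lambda>i j. ws ! i $ (enum_set T ! j)))"
    by (simp add: sum.If_cases)
  also have "\<dots> = minor_det d (\<lambda>i j. \<Sum>n\<in>UNIV. vs ! i $ n * ws ! j $ n)"
    by (simp add: cauchy_binet minor_det_transpose[of d "\<lambda>i j. ws ! i $ (enum_set _ ! j)"])
  finally show ?thesis by (simp add: inner_vec_def)
qed

lemma exterior_power_wedge: "exterior_power A *v wedge vs = wedge (map ((*v) A) vs)"
proof -
  define d where "d = length vs"
  have "(exterior_power A *v wedge vs) $ S = wedge (map ((*v) A) vs) $ S" for S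
  proof (cases "card S = d")
    case False
    have "exterior_power A $ S $ T * wedge vs $ T = 0" for T
      using False by (auto simp: exterior_power_def wedge_def enum_set(3) d_def)
    then have "(exterior_power A *v wedge vs) $ S = 0" by (simp only: matrix_vector_mult_def vec_lambda_beta sum.neutral_const)
    then show ?thesis using False by (simp add: wedge_def d_def)
  next
    case True
    have "(exterior_power A *v wedge vs) $ S = (\<Sum>T\<in>UNIV. if card T = d then 
       minor_det d (\<lambda>i j. vs ! i $ (enum_set T ! j)) * minor_det d (\<lambda>i j. A $ (enum_set S ! j) $ (enum_set T ! i)) else 0)"
      unfolding matrix_vector_mult_def vec_lambda_beta
    proof (rule sum.cong[OF refl])
      fix T :: "'a set"
      show "exterior_power A $ S $ T * wedge vs $ T = (if card T = d then 
       minor_det d (\<lambda>i j. vs ! i $ (enum_set T ! j)) * minor_det d (\<lambda>i j. A $ (enum_set S ! j) $ (enum_set T ! i)) else 0)"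
      proof (cases "card T = d")
        case T: True
        have "minor_det d (\<lambda>i j. map (\<lambda>t. column t A) (enum_set T) ! i $ (enum_set S ! j)) =
          minor_det d (\<lambda>i j. A $ (enum_set S ! j) $ (enum_set T ! i))"
          by (rule minor_det_cong) (simp add: enum_set(3) T column_def)
        then show ?thesis using T True by (simp add: exterior_power_def wedge_def enum_set(3) d_def)
      qed (simp add: wedge_def d_def)
    qed
    also have "\<dots> = (\<Sum>T | card T = d. minor_det d (\<lambda>i j. vs ! i $ (enum_set T ! j)) * 
        minor_det d (\<lambda>i j. A $ (enum_set S ! j) $ (enum_set T ! i)))"
      by (simp add: sum.If_cases)
    also have "\<dots> = minor_det d (\<lambda>i j. \<Sum>n\<in>UNIV. vs ! i $ n * A $ (enum_set S ! j) $ n)"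
      by (rule cauchy_binet[symmetric])
    also have "\<dots> = minor_det d (\<lambda>i j. map ((*v) A) vs ! i $ (enum_set S ! j))"
      by (rule minor_det_cong) (simp add: d_def matrix_vector_mult_def mult.commute)
    also have "\<dots> = wedge (map ((*v) A) vs) $ S" using True by (simp add: wedge_def d_def)
    finally show ?thesis .
  qed
  then show ?thesis by (simp add: vec_eq_iff)
qed

lemma transpose_exterior_power: "transpose (exterior_power A) = exterior_power (transpose A)"
proof -
  have "exterior_power A $ T $ S = exterior_power (transpose A) $ S $ T" for S T
  proof (cases "card S = card T")
    case True
    have "minor_det (card S) (\<lambda>i j. map (\<lambda>t. column t A) (enum_set S) ! i $ (enum_set T ! j)) =
       minor_det (card S) (\<lambda>i j. map (\<lambda>t. column t (transpose A)) (enum_set T) ! j $ (enum_set S ! i))"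
      by (rule minor_det_cong) (simp add: enum_set(3) True column_def transpose_def)
    also have "\<dots> = minor_det (card S) (\<lambda>i j. map (\<lambda>t. column t (transpose A)) (enum_set T) ! i $ (enum_set S ! j))"
      by (rule minor_det_transpose)
    finally show ?thesis using True by (simp add: exterior_power_def wedge_def enum_set(3))
  qed (auto simp: exterior_power_def wedge_def enum_set(3))
  then show ?thesis by (simp add: vec_eq_iff transpose_def)
qed

text \<open>Virtual zonoids in the \<open>d\<close>-th exterior power are regarded as virtual zonoids in the whole
  exterior algebra. The sample space is again fixed, since only the law of \<open>\<xi>\<close> matters.\<close>

definition grassmann_generators :: "nat \<Rightarrow> (real ^ ('n::finite set)) vzonoid set" where
  "grassmann_generators d = {virtual (zonoid_of M \<xi>) | (M :: (real ^ ('n set)) measure) \<xi>.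
     random_vector M \<xi> \<and> (AE \<omega> in M. simple_multivector d (\<xi> \<omega>))}"

definition grassmann_zonoids :: "nat \<Rightarrow> (real ^ ('n::finite set)) vzonoid set" where
  "grassmann_zonoids d = span (grassmann_generators d)"

definition null_zonoids :: "nat \<Rightarrow> (real ^ ('n::finite set)) vzonoid set" where
  "null_zonoids d = {K \<in> grassmann_zonoids d. \<forall>L\<in>grassmann_zonoids d. zonoid_pairing K L = 0}"

lemma bilinear_zonoid_pairing: "bilinear zonoid_pairing"
  by (rule is_zonoid_pairing[unfolded is_zonoid_pairing_def, THEN conjunct1])

lemma zonoid_pairing:
  fixes M N :: "'a::euclidean_space measure" and \<xi> \<zeta> :: "'a \<Rightarrow> 'a"
  assumes "random_vector M \<xi>" "random_vector N \<zeta>"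
  shows "zonoid_pairing (virtual (zonoid_of M \<xi>)) (virtual (zonoid_of N \<zeta>)) =
    (\<integral>z. \<bar>\<xi> (fst z) \<bullet> \<zeta> (snd z)\<bar> \<partial>(M \<Otimes>\<^sub>M N))"
  using is_zonoid_pairing[unfolded is_zonoid_pairing_def, THEN conjunct2, rule_format, OF assms] .

lemma subspace_grassmann_zonoids: "subspace (grassmann_zonoids d)"
  unfolding grassmann_zonoids_def by (rule subspace_span)

lemma subspace_null_zonoids: "subspace (null_zonoids d)"
proof (rule subspaceI)
  note bil = bilinear_zonoid_pairing
  note G = subspace_grassmann_zonoids
  show "0 \<in> null_zonoids d" by (simp add: null_zonoids_def subspace_0[OF G] bilinear_lzero[OF bil])
  show "x + y \<in> null_zonoids d" if "x \<in> null_zonoids d" "y \<in> null_zonoids d" for x y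
    using that by (simp add: null_zonoids_def subspace_add[OF G] bilinear_ladd[OF bil])
  show "c *\<^sub>R x \<in> null_zonoids d" if "x \<in> null_zonoids d" for c x
    using that by (simp add: null_zonoids_def subspace_scale[OF G] bilinear_lmul[OF bil])
qed

lemma grassmann_image:
  assumes "K \<in> grassmann_zonoids d"
  shows "vzonoid_image (exterior_power A) K \<in> grassmann_zonoids d"
proof -
  have "vzonoid_image (exterior_power A) ` grassmann_generators d \<subseteq> grassmann_generators d"
  proof safe
    fix X :: "(real ^ ('a set)) vzonoid" assume "X \<in> grassmann_generators d"
    then obtain M :: "(real ^ ('a set)) measure" and \<xi> where X: "X = virtual (zonoid_of M \<xi>)" "random_vector M \<xi>" 
       "AE \<omega> in M. simple_multivector d (\<xi> \<omega>)" by (auto simp: grassmann_generators_def)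
    have "AE \<omega> in M. simple_multivector d (exterior_power A *v \<xi> \<omega>)" using X(3)
      by eventually_elim (auto simp: simple_multivector_def exterior_power_wedge intro: exI[of _ "map _ _"])
    then show "vzonoid_image (exterior_power A) X \<in> grassmann_generators d"
      using random_vector_image[OF X(2)] unfolding grassmann_generators_def
      by (auto simp: X(1) vzonoid_image_virtual czonoid_image_zonoid_of[OF X(2)])
  qed
  then have "vzonoid_image (exterior_power A) ` span (grassmann_generators d) \<subseteq> span (grassmann_generators d)"
    unfolding linear_span_image[OF linear_vzonoid_image, symmetric] by (rule span_mono)
  then show ?thesis using assms by (auto simp: grassmann_zonoids_def)
qed

lemma zonoid_pairing_image:
  fixes K L :: "(real ^ ('n::finite set)) vzonoid"
  assumes "K \<in> grassmann_zonoids d" "L \<in> grassmann_zonoids d"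
  shows "zonoid_pairing (vzonoid_image (exterior_power A) K) L =
     zonoid_pairing K (vzonoid_image (exterior_power (transpose A)) L)"
proof -
  let ?A = "vzonoid_image (exterior_power A)" and ?A' = "vzonoid_image (exterior_power (transpose A))"
  note bil = bilinear_zonoid_pairing[unfolded bilinear_def]
  have gen: "zonoid_pairing (?A X) Y = zonoid_pairing X (?A' Y)" 
    if X: "X \<in> grassmann_generators d" and Y: "Y \<in> grassmann_generators d" for X Y
  proof -
    obtain M :: "(real ^ ('n set)) measure" and \<xi> where M: "X = virtual (zonoid_of M \<xi>)" "random_vector M \<xi>" 
      using X by (auto simp: grassmann_generators_def)
    obtain N :: "(real ^ ('n set)) measure" and \<zeta> where N: "Y = virtual (zonoid_of N \<zeta>)" "random_vector N \<zeta>" 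
      using Y by (auto simp: grassmann_generators_def)
    have "(exterior_power A *v x) \<bullet> y = x \<bullet> (exterior_power (transpose A) *v y)" for x y
      using dot_lmul_matrix[of y "exterior_power A" x] 
      by (simp add: transpose_exterior_power[symmetric] inner_commute)
    then show ?thesis
      by (simp add: M(1) N(1) vzonoid_image_virtual czonoid_image_zonoid_of M(2) N(2) zonoid_pairing random_vector_image)
  qed
  have lin1: "linear (\<lambda>X. zonoid_pairing (?A X) Y)" "linear (\<lambda>X. zonoid_pairing X (?A' Y))" for Y
    using linear_compose[OF linear_vzonoid_image, of "\<lambda>X. zonoid_pairing X Y" "exterior_power A"] bil by (auto simp: comp_def)
  have lin2: "linear (\<lambda>Y. zonoid_pairing (?A X) Y)" "linear (\<lambda>Y. zonoid_pairing X (?A' Y))" for X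
    using linear_compose[OF linear_vzonoid_image, of "\<lambda>Y. zonoid_pairing X Y" "exterior_power (transpose A)"] bil by (auto simp: comp_def)
  have "zonoid_pairing (?A X) L = zonoid_pairing X (?A' L)" if "X \<in> grassmann_generators d" for X
    by (rule linear_eq_on[OF lin2 assms(2)[unfolded grassmann_zonoids_def]]) (rule gen[OF that])
  then show ?thesis
    by (rule linear_eq_on[OF lin1 assms(1)[unfolded grassmann_zonoids_def]])
qed

lemma null_image:
  assumes "K \<in> null_zonoids d"
  shows "vzonoid_image (exterior_power A) K \<in> null_zonoids d"
  using assms grassmann_image[of _ d] zonoid_pairing_image[of K d] unfolding null_zonoids_def by auto

text \<open>The direct sum of the quotients \<open>grassmann_zonoids d / null_zonoids d\<close> is the type
  \<open>'n prob_algebra\<close>: an element is represented by a finitely supported family, and two families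
  are identified if they agree modulo \<open>null_zonoids d\<close> in each degree \<open>d\<close>.\<close>

definition graded_zonoids :: "(nat \<Rightarrow> (real ^ ('n::finite set)) vzonoid) set" where
  "graded_zonoids = {f. (\<forall>d. f d \<in> grassmann_zonoids d) \<and> finite {d. f d \<noteq> 0}}"

definition same_class :: "(nat \<Rightarrow> (real ^ ('n::finite set)) vzonoid) \<Rightarrow> (nat \<Rightarrow> (real ^ ('n set)) vzonoid) \<Rightarrow> bool" where
  "same_class f g \<longleftrightarrow> f \<in> graded_zonoids \<and> g \<in> graded_zonoids \<and> (\<forall>d. f d - g d \<in> null_zonoids d)"

lemma graded_zonoids_0: "(\<lambda>_. 0) \<in> graded_zonoids"
  by (simp add: graded_zonoids_def subspace_0[OF subspace_grassmann_zonoids])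

lemma graded_zonoids_add: 
  assumes "f \<in> graded_zonoids" "g \<in> graded_zonoids" shows "(\<lambda>d. f d + g d) \<in> graded_zonoids"
proof -
  have "finite ({d. f d \<noteq> 0} \<union> {d. g d \<noteq> 0})" using assms by (simp add: graded_zonoids_def)
  then have "finite {d. f d + g d \<noteq> 0}" by (rule rev_finite_subset) auto
  then show ?thesis using assms by (simp add: graded_zonoids_def subspace_add[OF subspace_grassmann_zonoids])
qed

lemma graded_zonoids_scale: 
  assumes "f \<in> graded_zonoids" shows "(\<lambda>d. c *\<^sub>R f d) \<in> graded_zonoids"
proof -
  have "finite {d. f d \<noteq> 0}" using assms by (simp add: graded_zonoids_def)
  then have "finite {d. c *\<^sub>R f d \<noteq> 0}" by (rule rev_finite_subset) auto
  then show ?thesis using assms by (simp add: graded_zonoids_def subspace_scale[OF subspace_grassmann_zonoids])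
qed

lemma graded_zonoids_image: 
  assumes "f \<in> graded_zonoids" shows "(\<lambda>d. vzonoid_image (exterior_power A) (f d)) \<in> graded_zonoids"
proof -
  have "finite {d. f d \<noteq> 0}" using assms by (simp add: graded_zonoids_def)
  then have "finite {d. vzonoid_image (exterior_power A) (f d) \<noteq> 0}"
    by (rule rev_finite_subset) (auto simp: linear_0[OF linear_vzonoid_image])
  then show ?thesis using assms by (simp add: graded_zonoids_def grassmann_image)
qed

lemma same_class_refl: "f \<in> graded_zonoids \<Longrightarrow> same_class f f"
  by (simp add: same_class_def subspace_0[OF subspace_null_zonoids])

lemma same_class_eqI: "f \<in> graded_zonoids \<Longrightarrow> f = g \<Longrightarrow> same_class f g"
  using same_class_refl by simp

lemma part_equivp_same_class: "part_equivp same_class"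
proof (rule part_equivpI)
  show "\<exists>f. same_class f f" using same_class_refl[OF graded_zonoids_0] by blast
  show "symp same_class"
  proof (rule sympI)
    fix f g assume "same_class f g"
    then show "same_class g f"
      using subspace_neg[OF subspace_null_zonoids] unfolding same_class_def by (metis minus_diff_eq)
  qed
  show "transp same_class"
  proof (rule transpI)
    fix f g h assume *: "same_class f g" "same_class g h"
    have "f d - h d = (f d - g d) + (g d - h d)" for d by simp
    then show "same_class f h"
      using * subspace_add[OF subspace_null_zonoids] unfolding same_class_def by metis
  qed
qed

quotient_type (overloaded) 'n prob_algebra = "nat \<Rightarrow> (real ^ ('n::finite set)) vzonoid" / partial: same_class
  by (rule part_equivp_same_class)

lemma same_class_graded: "same_class f g \<Longrightarrow> f \<in> graded_zonoids" by (simp add: same_class_def)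

instantiation prob_algebra :: (finite) real_vector
begin

lift_definition zero_prob_algebra :: "'a prob_algebra" is "\<lambda>_. 0"
  by (rule same_class_refl[OF graded_zonoids_0])

lift_definition plus_prob_algebra :: "'a prob_algebra \<Rightarrow> 'a prob_algebra \<Rightarrow> 'a prob_algebra"
  is "\<lambda>f g d. f d + g d"
  unfolding same_class_def by (auto simp: graded_zonoids_add add_diff_add intro: subspace_add[OF subspace_null_zonoids])

lift_definition scaleR_prob_algebra :: "real \<Rightarrow> 'a prob_algebra \<Rightarrow> 'a prob_algebra"
  is "\<lambda>c f d. c *\<^sub>R f d"
  unfolding same_class_def by (auto simp: graded_zonoids_scale simp flip: scaleR_diff_right intro: subspace_scale[OF subspace_null_zonoids])

definition uminus_prob_algebra :: "'a prob_algebra \<Rightarrow> 'a prob_algebra" where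
  "- X = (-1) *\<^sub>R (X :: 'a prob_algebra)"

definition minus_prob_algebra :: "'a prob_algebra \<Rightarrow> 'a prob_algebra \<Rightarrow> 'a prob_algebra" where
  "X - Y = X + - (Y :: 'a prob_algebra)"

instance
proof
  fix X Y Z :: "'a prob_algebra" and a b :: real
  note intros = same_class_eqI graded_zonoids_add graded_zonoids_scale graded_zonoids_0 same_class_graded
  show "X + Y + Z = X + (Y + Z)" by transfer (rule same_class_eqI; simp add: intros add.assoc)
  show "X + Y = Y + X" by transfer (rule same_class_eqI; simp add: intros add.commute)
  show "0 + X = X" by transfer (rule same_class_eqI; simp add: intros)
  show "- X + X = 0" unfolding uminus_prob_algebra_def
    by transfer (rule same_class_eqI; simp add: intros graded_zonoids_add[OF graded_zonoids_scale, of _ _ "-1", simplified])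
  show "X - Y = X + - Y" by (simp add: minus_prob_algebra_def)
  show "a *\<^sub>R (X + Y) = a *\<^sub>R X + a *\<^sub>R Y" by transfer (rule same_class_eqI; simp add: intros scaleR_add_right)
  show "(a + b) *\<^sub>R X = a *\<^sub>R X + b *\<^sub>R X" by transfer (rule same_class_eqI; simp add: intros scaleR_add_left)
  show "a *\<^sub>R b *\<^sub>R X = (a * b) *\<^sub>R X" by transfer (rule same_class_eqI; simp add: intros)
  show "1 *\<^sub>R X = X" by transfer (rule same_class_eqI; simp add: intros)
qed

end

text \<open>The action of the linear map \<open>A\<close> of \<open>V\<close>, induced by \<open>K(\<xi>) \<mapsto> K(A \<xi>)\<close>
  (\<open>vzonoid_image_virtual\<close>, \<open>czonoid_image_zonoid_of\<close>).\<close>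

lift_definition prob_action :: "real ^ 'n ^ 'n \<Rightarrow> 'n::finite prob_algebra \<Rightarrow> 'n prob_algebra"
  is "\<lambda>A f d. vzonoid_image (exterior_power A) (f d)"
  unfolding same_class_def 
  by (auto simp: graded_zonoids_image null_image simp flip: linear_diff[OF linear_vzonoid_image])

lemma linear_prob_action: "linear (prob_action A)"
proof (rule linearI)
  fix X Y :: "'a prob_algebra" and c :: real
  show "prob_action A (X + Y) = prob_action A X + prob_action A Y"
    by transfer (rule same_class_eqI; simp add: graded_zonoids_image graded_zonoids_add same_class_graded linear_add[OF linear_vzonoid_image])
  show "prob_action A (c *\<^sub>R X) = c *\<^sub>R prob_action A X"
    by transfer (rule same_class_eqI; simp add: graded_zonoids_image graded_zonoids_scale same_class_graded linear_scale[OF linear_vzonoid_image])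
qed

text \<open>The space \<open>real ^ 'k \<otimes> real ^ 'm\<close> is \<open>real ^ ('k \<times> 'm)\<close>, with \<open>e\<^sub>i \<otimes> f\<^sub>j\<close> the unit vector at \<open>(i, j)\<close>.\<close>

definition tensor_matrix :: "real ^ 'k ^ 'k \<Rightarrow> real ^ 'm ^ 'm \<Rightarrow> real ^ ('k \<times> 'm) ^ ('k \<times> 'm)" where
  "tensor_matrix g h = (\<chi> p q. g $ fst p $ fst q * h $ snd p $ snd q)"

definition prob_intersection_ring :: "('k::finite \<times> 'm::finite) prob_algebra set" where
  "prob_intersection_ring = {X. \<forall>g h. orthogonal_matrix g \<longrightarrow> orthogonal_matrix h \<longrightarrow>
     prob_action (tensor_matrix (g :: real ^ 'k ^ 'k) (h :: real ^ 'm ^ 'm)) X = X}"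

lemma subspace_prob_intersection_ring: "subspace prob_intersection_ring"
  unfolding prob_intersection_ring_def
  by (auto simp: subspace_def linear_0[OF linear_prob_action] linear_add[OF linear_prob_action]
      linear_scale[OF linear_prob_action])

end

theory Submission
  imports Defs
begin

text \<open>
  Every vector of \<open>V\<close> is simple of degree one, so an element of degree one is determined by its
  pairings with the segments \<open>K(u)\<close>, \<open>u \<in> V\<close>. Let \<open>\<xi>\<^sub>t = G + t x \<otimes> y\<close> with \<open>x\<close> uniform in a ball and
  \<open>(G, y)\<close> independent of \<open>x\<close> and uniform in a ball. By rotation invariance, \<open>E |\<langle>u, \<xi>\<^sub>t\<rangle>|\<close> is a constant
  times \<open>E sqrt (|u|\<^sup>2 + t\<^sup>2 |u\<^sup>T x|\<^sup>2)\<close>, which is invariant under \<open>H\<close>. For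
  \<open>u\<^sub>s = diag (sqrt s, sqrt (1 - s), 0, \<dots>)\<close> it equals \<open>E sqrt (1 + t\<^sup>2 q\<^sub>s)\<close> with
  \<open>q\<^sub>s = s x\<^sub>1\<^sup>2 + (1 - s) x\<^sub>2\<^sup>2\<close>. If the invariants were finite dimensional, there would be a linear
  relation between the evaluations at finitely many \<open>u\<^sub>s\<close>, \<open>1/2 < s < 1\<close>, valid for all \<open>t\<close>. Expanding
  in powers of \<open>t\<^sup>2\<close>, the same relation holds between the moments \<open>E q\<^sub>s\<^sup>n\<close> for every \<open>n\<close>. But \<open>q\<^sub>s\<close> has
  essential supremum \<open>s\<close>, so the moments of the largest \<open>s\<close> outgrow all the others.
\<close>

section \<open>The uniform distribution on the unit ball\<close>

lemma emeasure_lborel_reflect: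
  fixes A :: "'a::euclidean_space set"
  assumes "A \<in> sets borel"
  shows "(\<integral>\<^sup>+y. indicator A (c - y) \<partial>lborel) = emeasure lborel A"
proof -
  have "(\<integral>\<^sup>+y. indicator A y \<partial>lborel) = (\<integral>\<^sup>+y. indicator A (c - y) \<partial>(lborel :: 'a measure))"
    using assms by (subst lborel_affine[of "-1" c]) (simp_all add: nn_integral_density nn_integral_distr)
  then show ?thesis using assms by simp
qed

lemma nn_integral_lborel_translate:
  fixes g :: "'a::euclidean_space \<Rightarrow> ennreal"
  assumes "g \<in> borel_measurable borel"
  shows "(\<integral>\<^sup>+y. g (c + y) \<partial>lborel) = (\<integral>\<^sup>+y. g y \<partial>lborel)"
  using assms by (subst (2) lborel_distr_plus[symmetric, of c]) (simp add: nn_integral_distr)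

lemma emeasure_unit_ball: "emeasure lborel (ball (0::'a::euclidean_space) 1) \<noteq> 0"
    "emeasure lborel (ball (0::'a::euclidean_space) 1) \<noteq> \<top>"
  by (simp_all add: emeasure_ball less_imp_neq[OF unit_ball_vol_pos, symmetric])

text \<open>Translation invariance determines \<open>\<mu> = distr lborel borel f\<close> up to a factor: by Fubini,
  \<open>\<mu> A * lborel B\<close> and \<open>\<mu> B * lborel A\<close> agree. Take the unit ball for \<open>B\<close>, which \<open>f\<close> preserves.\<close>

lemma distr_lborel_orthogonal_transformation:
  fixes f :: "'a::euclidean_space \<Rightarrow> 'a"
  assumes f: "orthogonal_transformation f"
  shows "distr lborel borel f = lborel"
proof (rule measure_eqI)
  have lin: "linear f" using f by (rule orthogonal_transformation_linear)
  have [measurable]: "f \<in> borel_measurable borel"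
    using lin by (intro borel_measurable_continuous_onI linear_continuous_on) (simp add: linear_conv_bounded_linear)
  fix A :: "'a set" assume "A \<in> sets (distr lborel borel f)"
  then have A [measurable]: "A \<in> sets borel" by simp
  let ?B = "ball 0 1 :: 'a set"
  have B [measurable]: "?B \<in> sets borel" by simp
  define \<mu> where "\<mu> S = (\<integral>\<^sup>+x. indicator S (f x) \<partial>lborel)" for S
  have \<mu>: "emeasure (distr lborel borel f) S = \<mu> S" if [measurable]: "S \<in> sets borel" for S
    unfolding \<mu>_def by (subst nn_integral_indicator[symmetric], simp, subst nn_integral_distr) simp_all
  have "\<mu> A * emeasure lborel ?B = (\<integral>\<^sup>+x. indicator A (f x) * (\<integral>\<^sup>+y. indicator ?B (f x + y) \<partial>lborel) \<partial>lborel)"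
    by (subst nn_integral_lborel_translate) (simp_all add: \<mu>_def nn_integral_multc borel_measurable_indicator)
  also have "\<dots> = (\<integral>\<^sup>+x. (\<integral>\<^sup>+y. indicator A (f x) * indicator ?B (f x + y) \<partial>lborel) \<partial>lborel)"
    by (intro nn_integral_cong nn_integral_cmult[symmetric]) measurable
  also have "\<dots> = (\<integral>\<^sup>+y. (\<integral>\<^sup>+x. indicator A (f x) * indicator ?B (f x + y) \<partial>lborel) \<partial>lborel)"
    by (rule lborel_pair.Fubini') measurable
  also have "\<dots> = (\<integral>\<^sup>+y. (\<integral>\<^sup>+x. indicator A (f x - y) * indicator ?B (f x) \<partial>lborel) \<partial>lborel)"
  proof (rule nn_integral_cong)
    fix y :: 'a
    \<comment> \<open>Since \<open>f x + y = f (x + z)\<close>, a translation on the image side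
      becomes a translation of the integration variable, which Lebesgue measure ignores.\<close>
    obtain z where z: "y = f z" using orthogonal_transformation_surj[OF f] by (meson surjD)
    show "(\<integral>\<^sup>+x. indicator A (f x) * indicator ?B (f x + y) \<partial>lborel) =
        (\<integral>\<^sup>+x. indicator A (f x - y) * indicator ?B (f x) \<partial>lborel)"
      using nn_integral_lborel_translate[of "\<lambda>x. indicator A (f x - y) * indicator ?B (f x)" z]
      by (simp add: linear_add[OF lin] z add.commute)
  qed
  also have "\<dots> = (\<integral>\<^sup>+x. (\<integral>\<^sup>+y. indicator A (f x - y) * indicator ?B (f x) \<partial>lborel) \<partial>lborel)"
    by (rule lborel_pair.Fubini') measurable
  also have "\<dots> = emeasure lborel A * \<mu> ?B"
    by (simp add: nn_integral_multc emeasure_lborel_reflect nn_integral_cmult \<mu>_def borel_measurable_indicator)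
  also have "\<mu> ?B = emeasure lborel ?B"
  proof -
    have "\<mu> ?B = (\<integral>\<^sup>+x. indicator ?B x \<partial>lborel)" unfolding \<mu>_def
      by (intro nn_integral_cong) (simp add: indicator_def orthogonal_transformation_norm[OF f])
    then show ?thesis by simp
  qed
  finally have "emeasure lborel ?B * \<mu> A = emeasure lborel ?B * emeasure lborel A" by (simp add: mult.commute)
  then show "emeasure (distr lborel borel f) A = emeasure lborel A"
    using emeasure_unit_ball[where 'a='a] by (simp add: \<mu> ennreal_mult_cancel_left)
qed simp

text \<open>The ball serves better than the sphere: its uniform law is Lebesgue measure restricted
  and normalised, so rotation invariance is inherited, and bounded support makes locally bounded
  measurable functions such as continuous ones integrable.\<close>

definition unif_ball :: "'a::euclidean_space measure" where
  "unif_ball = uniform_measure lborel (ball 0 1)"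

lemma prob_space_unif_ball: "prob_space (unif_ball :: 'a::euclidean_space measure)"
  unfolding unif_ball_def using emeasure_unit_ball[where 'a='a]
  by (intro prob_space_uniform_measure) auto

lemma sets_unif_ball [measurable_cong, simp]: "sets unif_ball = sets borel"
  by (simp add: unif_ball_def)

lemma space_unif_ball [simp]: "space unif_ball = UNIV"
  by (simp add: unif_ball_def)

lemma AE_unif_ball: "AE x in unif_ball. norm x < 1"
  unfolding unif_ball_def by (rule AE_uniform_measureI) auto

text \<open>Every point of the open ball has neighbourhoods of positive mass. This gives both the
  positive constant in \<open>integral_unif_ball_inner\<close> and the essential suprema in the
  final argument.\<close>

lemma unif_ball_pos:
  assumes "open S" "x \<in> S" "norm x < 1"
  shows "0 < measure unif_ball S"
proof -
  interpret prob_space "unif_ball :: 'a measure" by (rule prob_space_unif_ball)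
  have "open (ball 0 1 \<inter> S)" "x \<in> ball 0 1 \<inter> S" using assms by auto
  then obtain e where e: "e > 0" "ball x e \<subseteq> ball 0 1 \<inter> S" by (meson open_contains_ball)
  have "0 < emeasure lborel (ball x e)" using e(1) by (simp add: emeasure_ball)
  also have "\<dots> \<le> emeasure lborel (ball 0 1 \<inter> S)"
    using e(2) assms(1) by (intro emeasure_mono) auto
  finally have "0 < emeasure lborel (ball 0 1 \<inter> S)" .
  then have "0 < emeasure unif_ball S" unfolding unif_ball_def
    using emeasure_unit_ball[where 'a='a] assms(1)
    by (subst emeasure_uniform_measure) (auto simp: ennreal_zero_less_divide less_top)
  then show ?thesis by (simp add: emeasure_eq_measure)
qed

lemma integrable_unif_ball:
  fixes f :: "'a::euclidean_space \<Rightarrow> 'b::{banach, second_countable_topology}"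
  assumes "f \<in> borel_measurable borel" "\<And>x. norm x < 1 \<Longrightarrow> norm (f x) \<le> C"
  shows "integrable unif_ball f"
proof -
  interpret prob_space "unif_ball :: 'a measure" by (rule prob_space_unif_ball)
  show ?thesis
    using assms AE_unif_ball by (intro integrable_const_bound[where B=C]) (auto elim: eventually_mono)
qed

lemma distr_unif_ball_orthogonal_transformation:
  fixes f :: "'a::euclidean_space \<Rightarrow> 'a"
  assumes f: "orthogonal_transformation f"
  shows "distr unif_ball borel f = unif_ball"
proof (rule measure_eqI)
  have [measurable]: "f \<in> borel_measurable borel"
    using orthogonal_transformation_linear[OF f]
    by (intro borel_measurable_continuous_onI linear_continuous_on) (simp add: linear_conv_bounded_linear)
  fix A assume "A \<in> sets (distr unif_ball borel f)"
  then have [measurable]: "A \<in> sets borel" by simp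
  have pre: "f -` A \<in> sets borel" using measurable_sets[of f borel borel A] by simp
  have "ball 0 1 \<inter> f -` A = f -` (ball 0 1 \<inter> A)"
    by (auto simp: orthogonal_transformation_norm[OF f])
  then have "emeasure lborel (ball 0 1 \<inter> f -` A) = emeasure (distr lborel borel f) (ball 0 1 \<inter> A)"
    by (simp add: emeasure_distr)
  then show "emeasure (distr unif_ball borel f) A = emeasure unif_ball A"
    using pre by (simp add: distr_lborel_orthogonal_transformation[OF f] emeasure_distr unif_ball_def)
qed simp

lemma integral_unif_ball_orthogonal_transformation:
  fixes f :: "'a::euclidean_space \<Rightarrow> 'a" and g :: "'a \<Rightarrow> 'b::{banach, second_countable_topology}"
  assumes f: "orthogonal_transformation f" and [measurable]: "g \<in> borel_measurable borel"
  shows "(\<integral>x. g (f x) \<partial>unif_ball) = (\<integral>x. g x \<partial>unif_ball)"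
proof -
  have [measurable]: "f \<in> borel_measurable borel"
    using orthogonal_transformation_linear[OF f]
    by (intro borel_measurable_continuous_onI linear_continuous_on) (simp add: linear_conv_bounded_linear)
  show ?thesis
    by (subst (2) distr_unif_ball_orthogonal_transformation[OF f, symmetric], subst integral_distr) simp_all
qed

lemma orthogonal_transformation_between:
  fixes a b :: "'a::euclidean_space"
  assumes "norm a = norm b"
  obtains f where "orthogonal_transformation f" "f a = b"
proof (cases "a = b")
  case True
  then show ?thesis using that[of id] by (simp add: orthogonal_transformation_def linear_id[unfolded id_def] linear_id id_def)
next
  case False
  \<comment> \<open>The map sought is the reflection in the hyperplane orthogonal to
    \<open>a - b\<close>.\<close>
  define v where "v = a - b"
  have v: "v \<bullet> v \<noteq> 0" using False by (simp add: v_def)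
  have "a \<bullet> a = b \<bullet> b" using assms by (simp add: norm_eq)
  \<comment> \<open>Equality of the norms makes the reflection coefficient of \<open>a\<close> equal
    to 1, so \<open>f a = a - v = b\<close>.\<close>
  then have av: "2 * (a \<bullet> v) = v \<bullet> v" by (simp add: v_def inner_diff_left inner_diff_right inner_commute)
  define f where "f = (\<lambda>x. x - (2 * (x \<bullet> v) / (v \<bullet> v)) *\<^sub>R v)"
  have "linear f"
    by (rule linearI) (simp_all add: f_def inner_add_left algebra_simps add_divide_distrib)
  moreover have "f x \<bullet> f y = x \<bullet> y" for x y
    using v by (simp add: f_def inner_diff_left inner_diff_right inner_commute field_simps)
  moreover have "f a = b" using v by (simp add: f_def av) (simp add: v_def)
  ultimately show ?thesis using that[of f] by (simp add: orthogonal_transformation_def)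
qed

text \<open>Rotations act transitively on spheres, so invariance of the law and homogeneity reduce
  every \<open>w\<close> to one unit vector. In terms of zonoids, \<open>K\<close> of the uniform
  law is a ball of radius \<open>c / 2\<close>.\<close>

lemma integral_unif_ball_inner:
  obtains c where "c > 0" "\<And>w. (\<integral>x. \<bar>w \<bullet> x\<bar> \<partial>(unif_ball :: 'a::euclidean_space measure)) = c * norm w"
proof -
  interpret prob_space "unif_ball :: 'a measure" by (rule prob_space_unif_ball)
  obtain e :: 'a where e: "norm e = 1" using vector_choose_size[of 1] by auto
  define I where "I w = (\<integral>x. \<bar>w \<bullet> x\<bar> \<partial>(unif_ball :: 'a measure))" for w
  have "I w = I e * norm w" for w
  proof -
    obtain f where f: "orthogonal_transformation f" "f (norm w *\<^sub>R e) = w"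
      using orthogonal_transformation_between[of "norm w *\<^sub>R e" w] e by auto
    have "I w = (\<integral>x. \<bar>w \<bullet> f x\<bar> \<partial>(unif_ball :: 'a measure))"
      unfolding I_def by (rule integral_unif_ball_orthogonal_transformation[OF f(1), symmetric]) simp
    also have "\<dots> = (\<integral>x. norm w * \<bar>e \<bullet> x\<bar> \<partial>(unif_ball :: 'a measure))"
    proof (rule Bochner_Integration.integral_cong[OF refl])
      fix x
      have "w \<bullet> f x = (norm w *\<^sub>R e) \<bullet> x" using f by (metis orthogonal_transformation_def)
      then show "\<bar>w \<bullet> f x\<bar> = norm w * \<bar>e \<bullet> x\<bar>" by (simp add: abs_mult)
    qed
    finally show ?thesis by (simp add: I_def mult.commute)
  qed
  moreover have "I e > 0"
  proof -
    \<comment> \<open>On this half-space the integrand exceeds 1/4; it contains \<open>e / 2\<close>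
      and so has positive mass.\<close>
    let ?S = "{x. 1 / 4 < e \<bullet> x}"
    have op: "open ?S" by (intro open_Collect_less continuous_intros)
    have "0 < measure unif_ball ?S"
    proof (rule unif_ball_pos[OF op])
      show "(1 / 2) *\<^sub>R e \<in> ?S" using e by (simp add: dot_square_norm)
      show "norm ((1 / 2) *\<^sub>R e) < 1" using e by simp
    qed
    then have "0 < (\<integral>x. 1 / 4 * indicat_real ?S x \<partial>(unif_ball :: 'a measure))" using op by simp
    also have "\<dots> \<le> I e" unfolding I_def
    proof (rule integral_mono)
      show "integrable unif_ball (\<lambda>x. \<bar>e \<bullet> x\<bar>)"
      proof (rule integrable_unif_ball[where C=1])
        show "norm \<bar>e \<bullet> x\<bar> \<le> 1" if "norm x < 1" for x
          using Cauchy_Schwarz_ineq2[of e x] e that by simp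
      qed simp
      show "integrable unif_ball (\<lambda>x. 1 / 4 * indicator ?S x :: real)"
        using op by (intro integrable_mult_right integrable_real_indicator) (auto simp: emeasure_eq_measure)
    qed (auto simp: indicator_def)
    finally show ?thesis .
  qed
  ultimately show ?thesis using that unfolding I_def by blast
qed

section \<open>Moments\<close>

text \<open>Divide by the power of \<open>t\<close> at the first nonzero coefficient: the quotient
  still vanishes for small positive \<open>t\<close>, and by continuity at 0 that coefficient is
  0.\<close>

lemma powser_sums_0_imp_coeff_0:
  fixes a :: "nat \<Rightarrow> real"
  assumes sums: "\<And>t. 0 < t \<Longrightarrow> t < 1 \<Longrightarrow> (\<lambda>n. a n * t ^ n) sums 0"
  shows "a n = 0"
proof (rule ccontr)
  assume "a n \<noteq> 0"
  define N where "N = (LEAST n. a n \<noteq> 0)"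
  have N: "a N \<noteq> 0" unfolding N_def by (rule LeastI) fact
  have less: "a n = 0" if "n < N" for n using not_less_Least that unfolding N_def by blast
  have shifted: "(\<lambda>n. a (n + N) * t ^ n) sums 0" if t: "0 < t" "t < 1" for t
  proof -
    have "(\<lambda>n. a (n + N) * t ^ (n + N)) sums 0"
      using sums[OF t] less by (subst sums_iff_shift) simp
    from sums_mult[OF this, of "1 / t ^ N"] show ?thesis using t by (simp add: power_add)
  qed
  define f where "f t = (\<Sum>n. a (n + N) * t ^ n)" for t
  have "isCont f 0" unfolding f_def
    by (rule isCont_powser[where K="1/2"]) (use shifted[of "1/2"] in \<open>auto simp: sums_iff\<close>)
  then have "(f \<longlongrightarrow> f 0) (at_right 0)" by (simp add: isCont_def filterlim_at_split)
  moreover have "\<forall>\<^sub>F t in at_right 0. f t = 0"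
    using shifted by (intro eventually_at_rightI[of 0 1]) (auto simp: f_def sums_iff)
  then have "(f \<longlongrightarrow> 0) (at_right 0)" by (rule tendsto_eventually)
  ultimately have "f 0 = 0" using tendsto_unique trivial_limit_at_right_real by blast
  then show False using N by (simp add: f_def)
qed

text \<open>As 1/2 is not a natural number, no factor \<open>1/2 - i\<close> of the product
  vanishes. Hence the expansion of the square root retains the moments of every order.\<close>

lemma half_gchoose_neq_0: "(1 / 2 :: real) gchoose n \<noteq> 0"
proof -
  have "(1 / 2 :: real) \<noteq> of_nat i" for i
  proof
    assume "(1 / 2 :: real) = of_nat i"
    then have "real (2 * i) = real 1" by simp
    then have "2 * i = 1" by (simp only: of_nat_eq_iff)
    then show False by presburger
  qed
  then show ?thesis by (simp add: gbinomial_prod_rev)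
qed

text \<open>The binomial series is integrated term by term; \<open>q\<close> is bounded by 1, so the
  absolutely convergent series at \<open>t\<close> dominates.\<close>

lemma (in prob_space) sums_expectation_sqrt:
  fixes q :: "'a \<Rightarrow> real"
  assumes [measurable]: "q \<in> borel_measurable M" and q: "AE x in M. \<bar>q x\<bar> \<le> 1" and t: "0 < t" "t < 1"
  shows "(\<lambda>n. ((1 / 2) gchoose n) * expectation (\<lambda>x. q x ^ n) * t ^ n) sums expectation (\<lambda>x. sqrt (1 + t * q x))"
proof -
  define f where "f n x = ((1 / 2) gchoose n) * (t * q x) ^ n" for n x
  have int: "integrable M (\<lambda>x. q x ^ n)" for n
    by (rule integrable_const_bound[where B=1]) (use q in \<open>auto elim!: eventually_mono simp: power_abs power_le_one\<close>)
  have f_eq: "f n = (\<lambda>x. ((1 / 2) gchoose n) * t ^ n * q x ^ n)" for n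
    by (simp add: f_def fun_eq_iff power_mult_distrib)
  have f_le: "AE x in M. \<forall>n. norm (f n x) \<le> norm (((1 / 2) gchoose n) * t ^ n)"
    using q
  proof eventually_elim
    case (elim x)
    then have "\<bar>t * q x\<bar> ^ n \<le> t ^ n" for n
      using t by (intro power_mono) (auto simp: abs_mult intro: mult_left_le)
    then show ?case using t by (auto simp: f_def abs_mult power_abs intro!: mult_left_mono)
  qed
  \<comment> \<open>The series converges at \<open>(1 + t) / 2\<close>, which lies strictly between
    \<open>t\<close> and 1, hence absolutely at \<open>t\<close>.\<close>
  have summ: "summable (\<lambda>n. norm (((1 / 2 :: real) gchoose n) * t ^ n))"
    using t sums_summable[OF gen_binomial_real[of "(1 + t) / 2" "1 / 2"]] by (intro powser_insidea) auto
  have "(\<lambda>n. integral\<^sup>L M (f n)) sums (\<integral>x. (\<Sum>n. f n x) \<partial>M)"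
  proof (rule sums_integral)
    show int_f: "integrable M (f n)" for n unfolding f_eq by (intro integrable_mult_right int)
    show "AE x in M. summable (\<lambda>n. norm (f n x))" using f_le
      by eventually_elim (rule summable_comparison_test'[OF summ, of 0], simp)
    show "summable (\<lambda>n. \<integral>x. norm (f n x) \<partial>M)"
    proof (rule summable_comparison_test'[OF summ, of 0])
      fix n
      have "(\<integral>x. norm (f n x) \<partial>M) \<le> (\<integral>x. norm (((1 / 2) gchoose n) * t ^ n) \<partial>M)"
        using f_le int_f by (intro integral_mono_AE) (auto elim!: eventually_mono)
      then show "norm (\<integral>x. norm (f n x) \<partial>M) \<le> norm (((1 / 2) gchoose n) * t ^ n)"
        by (simp add: prob_space)
    qed
  qed
  moreover have "(\<integral>x. (\<Sum>n. f n x) \<partial>M) = expectation (\<lambda>x. sqrt (1 + t * q x))"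
  proof (rule integral_cong_AE)
    show "AE x in M. (\<Sum>n. f n x) = sqrt (1 + t * q x)" using q
    proof eventually_elim
      case (elim x)
      have "\<bar>t * q x\<bar> \<le> t" using elim t by (auto simp: abs_mult intro: mult_left_le)
      then have "\<bar>t * q x\<bar> < 1" using t by linarith
      with gen_binomial_real[OF this, of "1 / 2"] show ?case
        by (simp add: f_def sums_iff powr_half_sqrt)
    qed
  qed (simp_all add: f_def)
  moreover have "integral\<^sup>L M (f n) = ((1 / 2) gchoose n) * expectation (\<lambda>x. q x ^ n) * t ^ n" for n
    by (simp add: f_eq)
  ultimately show ?thesis by simp
qed

text \<open>The hypothesis is a power series in \<open>t\<close> vanishing on the interval from 0 to
  1; its coefficient of order \<open>n\<close> is the moment relation times a nonzero binomial
  coefficient.\<close>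

lemma (in prob_space) moments_eq_0:
  fixes q :: "'j \<Rightarrow> 'a \<Rightarrow> real"
  assumes "\<And>j. j \<in> J \<Longrightarrow> q j \<in> borel_measurable M" "\<And>j. j \<in> J \<Longrightarrow> AE x in M. \<bar>q j x\<bar> \<le> 1"
    and eq: "\<And>t. 0 < t \<Longrightarrow> t < 1 \<Longrightarrow> (\<Sum>j\<in>J. c j * expectation (\<lambda>x. sqrt (1 + t * q j x))) = 0"
  shows "(\<Sum>j\<in>J. c j * expectation (\<lambda>x. q j x ^ n)) = 0"
proof -
  have "((1 / 2) gchoose n) * (\<Sum>j\<in>J. c j * expectation (\<lambda>x. q j x ^ n)) = 0"
  proof (rule powser_sums_0_imp_coeff_0)
    fix t :: real assume t: "0 < t" "t < 1"
    have "(\<lambda>n. \<Sum>j\<in>J. c j * (((1 / 2) gchoose n) * expectation (\<lambda>x. q j x ^ n) * t ^ n)) sums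
        (\<Sum>j\<in>J. c j * expectation (\<lambda>x. sqrt (1 + t * q j x)))"
      using assms t by (intro sums_sum sums_mult sums_expectation_sqrt)
    then show "(\<lambda>n. ((1 / 2) gchoose n) * (\<Sum>j\<in>J. c j * expectation (\<lambda>x. q j x ^ n)) * t ^ n) sums 0"
      using eq[OF t] by (simp add: sum_distrib_left sum_distrib_right mult_ac)
  qed
  then show ?thesis using half_gchoose_neq_0[of n] by simp
qed

text \<open>Each \<open>s\<close> is the essential supremum of \<open>q s\<close>, so it is the
  exponential growth rate of the moments. The largest \<open>s\<close> with nonzero coefficient
  would then dominate the relation for large \<open>n\<close>.\<close>

lemma (in prob_space) coefficients_eq_0_if_moments_eq_0:
  fixes q :: "real \<Rightarrow> 'a \<Rightarrow> real"
  assumes J: "finite J" "\<And>s. s \<in> J \<Longrightarrow> 0 < s"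
    and meas: "\<And>s. s \<in> J \<Longrightarrow> q s \<in> borel_measurable M"
    and q: "\<And>s. s \<in> J \<Longrightarrow> AE x in M. 0 \<le> q s x \<and> q s x \<le> s"
    and pos: "\<And>s r. s \<in> J \<Longrightarrow> r < s \<Longrightarrow> 0 < prob {x \<in> space M. r < q s x}"
    and eq: "\<And>n. (\<Sum>s\<in>J. c s * expectation (\<lambda>x. q s x ^ n)) = 0"
    and s: "s \<in> J"
  shows "c s = 0"
proof (rule ccontr)
  assume "c s \<noteq> 0"
  define J' where "J' = {s \<in> J. c s \<noteq> 0}"
  have J': "finite J'" "J' \<noteq> {}" "J' \<subseteq> J" using J s \<open>c s \<noteq> 0\<close> by (auto simp: J'_def)
  define S where "S = Max J'"
  have S: "S \<in> J" "c S \<noteq> 0" "S \<in> J'" using Max_in[OF J'(1,2)] by (auto simp: S_def J'_def)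
  then have "0 < S" using J by simp
  \<comment> \<open>A bound for all remaining growth rates. Inserting \<open>S / 2\<close> keeps it
    positive and covers the case that \<open>S\<close> is the only index left.\<close>
  define r\<^sub>0 where "r\<^sub>0 = Max (insert (S / 2) (J' - {S}))"
  have r0: "0 < r\<^sub>0" "r\<^sub>0 < S" "\<And>s. s \<in> J' - {S} \<Longrightarrow> s \<le> r\<^sub>0"
  proof -
    have "S / 2 \<le> r\<^sub>0" unfolding r\<^sub>0_def using J' by (intro Max_ge) auto
    then show "0 < r\<^sub>0" using \<open>0 < S\<close> by linarith
    show "r\<^sub>0 < S" unfolding r\<^sub>0_def using J' \<open>0 < S\<close> Max_ge[OF J'(1), folded S_def]
      by (subst Max_less_iff) (auto simp: less_le)
    show "s \<le> r\<^sub>0" if "s \<in> J' - {S}" for s unfolding r\<^sub>0_def using J' that by (intro Max_ge) auto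
  qed
  \<comment> \<open>Strictly between the two: above \<open>r\<^sub>0\<close>, so that
    \<open>r ^ n\<close> outgrows \<open>r\<^sub>0 ^ n\<close>, and below \<open>S\<close>, so that
    \<open>q S\<close> exceeds it with positive probability.\<close>
  define r where "r = (r\<^sub>0 + S) / 2"
  have r: "r\<^sub>0 < r" "r < S" using r0 by (auto simp: r_def)
  define p where "p = prob {x \<in> space M. r < q S x}"
  have p: "0 < p" unfolding p_def by (rule pos[OF S(1) r(2)])
  have int: "integrable M (\<lambda>x. q s x ^ n)" if "s \<in> J" for s n
  proof (rule integrable_const_bound[where B="s ^ n"])
    show "AE x in M. norm (q s x ^ n) \<le> s ^ n"
      using q[OF that] by eventually_elim (auto simp: power_abs intro!: power_mono)
  qed (use meas[OF that] in simp)
  have E_le: "\<bar>expectation (\<lambda>x. q s x ^ n)\<bar> \<le> r\<^sub>0 ^ n" if "s \<in> J' - {S}" for s n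
  proof -
    have s: "s \<in> J" using that J' by auto
    have "0 \<le> expectation (\<lambda>x. q s x ^ n)"
      using q[OF s] by (intro integral_nonneg_AE) (auto elim!: eventually_mono)
    moreover have "expectation (\<lambda>x. q s x ^ n) \<le> expectation (\<lambda>x. r\<^sub>0 ^ n)"
    proof (rule integral_mono_AE[OF int[OF s]])
      show "AE x in M. q s x ^ n \<le> r\<^sub>0 ^ n"
        using q[OF s]
      proof eventually_elim
        case (elim x)
        then show ?case using r0(3)[OF that] power_mono[of "q s x" r\<^sub>0 n] by linarith
      qed
    qed simp
    ultimately show ?thesis by (simp add: prob_space)
  qed
  have E_ge: "p * r ^ n \<le> expectation (\<lambda>x. q S x ^ n)" for n
  proof -
    have [measurable]: "q S \<in> borel_measurable M" using meas S by simp
    have "p * r ^ n = expectation (\<lambda>x. r ^ n * indicat_real {x \<in> space M. r < q S x} x)"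
      by (simp add: p_def mult.commute)
    also have "\<dots> \<le> expectation (\<lambda>x. q S x ^ n)"
    proof (rule integral_mono_AE)
      show "integrable M (\<lambda>x. r ^ n * indicat_real {x \<in> space M. r < q S x} x)"
        by (intro integrable_mult_right integrable_real_indicator) (auto simp: emeasure_eq_measure)
      show "AE x in M. r ^ n * indicat_real {x \<in> space M. r < q S x} x \<le> q S x ^ n"
        using q[OF S(1)]
      proof eventually_elim
        case (elim x)
        then show ?case using r r0(1) power_mono[of r "q S x" n] by (simp add: indicator_def)
      qed
    qed (rule int[OF S(1)])
    finally show ?thesis .
  qed
  define C where "C = (\<Sum>s\<in>J' - {S}. \<bar>c s\<bar>)"
  have "\<bar>c S\<bar> * p * (r / r\<^sub>0) ^ n \<le> C" for n
  proof -
    have "(\<Sum>s\<in>J'. c s * expectation (\<lambda>x. q s x ^ n)) = 0"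
      using eq[of n] J by (subst (asm) sum.mono_neutral_right[of J J']) (auto simp: J'_def)
    then have "c S * expectation (\<lambda>x. q S x ^ n) = - (\<Sum>s\<in>J' - {S}. c s * expectation (\<lambda>x. q s x ^ n))"
      using S J' by (subst (asm) sum.remove[of _ S]) auto
    then have "\<bar>c S\<bar> * \<bar>expectation (\<lambda>x. q S x ^ n)\<bar> = \<bar>\<Sum>s\<in>J' - {S}. c s * expectation (\<lambda>x. q s x ^ n)\<bar>"
      by (simp flip: abs_mult)
    also have "\<dots> \<le> (\<Sum>s\<in>J' - {S}. \<bar>c s * expectation (\<lambda>x. q s x ^ n)\<bar>)"
      by (rule sum_abs)
    also have "\<dots> \<le> (\<Sum>s\<in>J' - {S}. \<bar>c s\<bar> * r\<^sub>0 ^ n)"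
      by (intro sum_mono) (auto simp: abs_mult intro!: mult_left_mono E_le)
    also have "\<dots> = C * r\<^sub>0 ^ n" by (simp add: C_def sum_distrib_right)
    finally have "\<bar>c S\<bar> * (p * r ^ n) \<le> C * r\<^sub>0 ^ n"
      using mult_left_mono[OF order_trans[OF E_ge abs_ge_self], of "\<bar>c S\<bar>" n] by simp
    then show ?thesis using r0(1) by (simp add: power_divide divide_le_eq mult.assoc)
  qed
  moreover
  obtain n where "C / (\<bar>c S\<bar> * p) < (r / r\<^sub>0) ^ n"
    using real_arch_pow[of "r / r\<^sub>0"] r r0 by auto
  then have "C < \<bar>c S\<bar> * p * (r / r\<^sub>0) ^ n" using p S by (simp add: divide_less_eq mult.commute)
  ultimately show False by (meson not_less)
qed

section \<open>Elements of degree one\<close>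

text \<open>Gaussian elimination for a homogeneous system with more unknowns \<open>c i\<close> than
  equations \<open>b\<close>. It will be applied to the values of functionals on a finite spanning
  set.\<close>

lemma exists_annihilating_combination:
  fixes a :: "'i \<Rightarrow> 'b \<Rightarrow> 'c::field"
  assumes "finite B" "finite I" "card B < card I"
  shows "\<exists>c. (\<exists>i\<in>I. c i \<noteq> 0) \<and> (\<forall>b\<in>B. (\<Sum>i\<in>I. c i * a i b) = 0)"
  using assms
proof (induction B arbitrary: I a rule: finite_induct)
  case empty
  then have "I \<noteq> {}" by auto
  then show ?case by (intro exI[of _ "\<lambda>_. 1"]) auto
next
  case (insert b B)
  show ?case
  proof (cases "\<forall>i\<in>I. a i b = 0")
    case True
    then show ?thesis using insert.IH[of I a] insert.prems insert.hyps by auto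
  next
    case False
    then obtain i\<^sub>0 where i0: "i\<^sub>0 \<in> I" "a i\<^sub>0 b \<noteq> 0" by blast
    \<comment> \<open>Subtracting a multiple of row \<open>i\<^sub>0\<close> clears column
      \<open>b\<close>; the induction hypothesis then handles the other columns.\<close>
    let ?a = "\<lambda>i b'. a i b' - a i b / a i\<^sub>0 b * a i\<^sub>0 b'"
    have "card B < card (I - {i\<^sub>0})" using insert.prems insert.hyps i0 by simp
    with insert.IH[of "I - {i\<^sub>0}" ?a] insert.prems obtain c where
      c: "\<exists>i\<in>I - {i\<^sub>0}. c i \<noteq> 0" "\<And>b'. b' \<in> B \<Longrightarrow> (\<Sum>i\<in>I - {i\<^sub>0}. c i * ?a i b') = 0" by auto
    \<comment> \<open>Minus this value, as coefficient of the pivot row, makes the equation for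
      \<open>b\<close> hold.\<close>
    define k where "k = (\<Sum>i\<in>I - {i\<^sub>0}. c i * a i b) / a i\<^sub>0 b"
    define c' where "c' = c(i\<^sub>0 := - k)"
    have sum: "(\<Sum>i\<in>I. c' i * a i b') = (\<Sum>i\<in>I - {i\<^sub>0}. c i * a i b') - k * a i\<^sub>0 b'" for b'
      using i0 insert.prems by (subst sum.remove[of _ i\<^sub>0]) (simp_all add: c'_def)
    have "(\<Sum>i\<in>I. c' i * a i b) = 0" using i0 by (simp add: sum k_def)
    moreover have "(\<Sum>i\<in>I. c' i * a i b') = 0" if "b' \<in> B" for b'
    proof -
      have "(\<Sum>i\<in>I - {i\<^sub>0}. c i * ?a i b') = (\<Sum>i\<in>I - {i\<^sub>0}. c i * a i b') - k * a i\<^sub>0 b'"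
        by (simp add: k_def right_diff_distrib sum_subtractf sum_distrib_left sum_divide_distrib mult_ac)
      then show ?thesis using c(2)[OF that] by (simp add: sum)
    qed
    moreover have "\<exists>i\<in>I. c' i \<noteq> 0" using c(1) by (auto simp: c'_def)
    ultimately show ?thesis by blast
  qed
qed

lemma minor_det_one: "minor_det (Suc 0) M = M 0 0"
proof -
  have "{p. p permutes {..<Suc 0}} = {id}" by (auto simp: permutes_sing lessThan_Suc)
  then show ?thesis by (simp add: minor_det_def)
qed

text \<open>Degree one is an isometric copy of \<open>V\<close>, so its pairings can be computed in
  \<open>V\<close>.\<close>

lemma inner_wedge_singleton: "wedge [v] \<bullet> wedge [w] = v \<bullet> w"
  by (simp add: inner_wedge[of _ "Suc 0"] minor_det_one)

lemma linear_wedge_singleton: "linear (\<lambda>v. wedge [v])"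
  by (rule linearI) (simp_all add: wedge_def vec_eq_iff minor_det_one)

lemma borel_measurable_wedge_singleton [measurable]: "(\<lambda>v. wedge [v]) \<in> borel_measurable borel"
  using linear_wedge_singleton
  by (intro borel_measurable_continuous_onI linear_continuous_on) (simp add: linear_conv_bounded_linear)

text \<open>The generators and the pairing are defined over sample spaces of type
  \<open>real ^ ('n set)\<close>. A vector on any other space is therefore replaced by its law, with
  the identity as random vector.\<close>

definition vector_law :: "'s measure \<Rightarrow> ('s \<Rightarrow> real ^ 'n) \<Rightarrow> (real ^ ('n::finite set)) measure" where
  "vector_law M X = distr M borel (\<lambda>\<omega>. wedge [X \<omega>])"

definition vector_zonoid :: "'s measure \<Rightarrow> ('s \<Rightarrow> real ^ 'n) \<Rightarrow> (real ^ ('n::finite set)) vzonoid" where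
  "vector_zonoid M X = virtual (zonoid_of (vector_law M X) (\<lambda>x. x))"

lemma random_vector_vector_law:
  assumes "random_vector M X"
  shows "random_vector (vector_law M X) (\<lambda>x. x)"
proof -
  have [measurable]: "X \<in> borel_measurable M" using assms by (auto simp: random_vector_def)
  have "integrable M (\<lambda>\<omega>. wedge [X \<omega>])"
    using assms linear_wedge_singleton integrable_bounded_linear[of "\<lambda>v. wedge [v]" M X]
    by (simp add: random_vector_def linear_conv_bounded_linear)
  then show ?thesis using assms unfolding random_vector_def vector_law_def
    by (auto simp: integrable_distr_eq intro!: prob_space.prob_space_distr)
qed

lemma vector_zonoid_in_grassmann_zonoids:
  assumes "random_vector M X"
  shows "vector_zonoid M X \<in> grassmann_zonoids 1"
proof -
  have [measurable]: "X \<in> borel_measurable M" using assms by (auto simp: random_vector_def)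
  \<comment> \<open>A linear subspace is closed, hence measurable, as the transfer of an almost sure
    statement to the image measure requires.\<close>
  have "closed (range (\<lambda>v :: real ^ 'b. wedge [v]))"
    using closed_subspace[OF linear_subspace_image[OF linear_wedge_singleton subspace_UNIV]] .
  then have "AE x in vector_law M X. x \<in> range (\<lambda>v. wedge [v])"
    unfolding vector_law_def by (subst AE_distr_iff) auto
  then have "AE x in vector_law M X. simple_multivector 1 x"
    by eventually_elim (auto simp: simple_multivector_def intro: exI[of _ "[_]"])
  then show ?thesis
    using random_vector_vector_law[OF assms] unfolding grassmann_zonoids_def vector_zonoid_def
    by (intro span_base) (auto simp: grassmann_generators_def)
qed

lemma integral_vector_law:
  fixes g :: "_ \<Rightarrow> real"
  assumes "random_vector M X" "g \<in> borel_measurable borel"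
  shows "(\<integral>x. g x \<partial>vector_law M X) = (\<integral>\<omega>. g (wedge [X \<omega>]) \<partial>M)"
proof -
  have [measurable]: "X \<in> borel_measurable M" using assms by (auto simp: random_vector_def)
  show ?thesis using assms(2) unfolding vector_law_def by (subst integral_distr) simp_all
qed

text \<open>The zonoid of a constant vector is a segment, and pairing with it yields twice the
  support function at that vector.\<close>

lemma zonoid_pairing_vector_zonoid_const:
  assumes "random_vector M X" "prob_space N"
  shows "zonoid_pairing (vector_zonoid M X) (vector_zonoid N (\<lambda>_. u)) = (\<integral>\<omega>. \<bar>u \<bullet> X \<omega>\<bar> \<partial>M)"
proof -
  interpret N: prob_space N by fact
  have N: "random_vector N (\<lambda>_. u)" using assms(2) by (simp add: random_vector_def)
  note rv = random_vector_vector_law[OF assms(1)] random_vector_vector_law[OF N]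
  have "zonoid_pairing (vector_zonoid M X) (vector_zonoid N (\<lambda>_. u)) =
      (\<integral>x. \<integral>y. \<bar>x \<bullet> y\<bar> \<partial>vector_law N (\<lambda>_. u) \<partial>vector_law M X)"
    unfolding vector_zonoid_def by (simp add: zonoid_pairing[OF rv] product_integral(1)[OF rv])
  also have "\<dots> = (\<integral>x. \<bar>x \<bullet> wedge [u]\<bar> \<partial>vector_law M X)"
    by (simp add: integral_vector_law[OF N] N.prob_space)
  also have "\<dots> = (\<integral>\<omega>. \<bar>u \<bullet> X \<omega>\<bar> \<partial>M)"
    by (simp add: integral_vector_law[OF assms(1)] inner_wedge_singleton inner_commute)
  finally show ?thesis .
qed

text \<open>A centered zonoid is determined by its support function, so invariance of first absolute
  moments suffices, rather than of the law of \<open>X\<close>.\<close>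

lemma vzonoid_image_vector_zonoid:
  assumes X: "random_vector M X"
    and inv: "\<And>u. (\<integral>\<omega>. \<bar>(transpose A *v u) \<bullet> X \<omega>\<bar> \<partial>M) = (\<integral>\<omega>. \<bar>u \<bullet> X \<omega>\<bar> \<partial>M)"
  shows "vzonoid_image (exterior_power A) (vector_zonoid M X) = vector_zonoid M X"
proof -
  \<comment> \<open>Test vectors range over the whole exterior algebra; the adjoint of the embedding
    projects them to \<open>V\<close>, where \<open>inv\<close> applies.\<close>
  define \<pi> where "\<pi> = adjoint (\<lambda>v :: real ^ 'b. wedge [v])"
  have \<pi>: "\<pi> U \<bullet> v = U \<bullet> wedge [v]" for U v
    unfolding \<pi>_def by (rule adjoint_clauses(2)[OF linear_wedge_singleton])
  have \<pi>_image: "\<pi> (transpose (exterior_power A) *v U) = transpose A *v \<pi> U" for U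
  proof -
    have "\<pi> (transpose (exterior_power A) *v U) \<bullet> v = (transpose A *v \<pi> U) \<bullet> v" for v
      by (simp add: \<pi> dot_lmul_matrix exterior_power_wedge)
    then show ?thesis using vector_eq_rdot by blast
  qed
  let ?K = "zonoid_of (vector_law M X) (\<lambda>x. x)"
  have supp: "supp ?K U = (\<integral>\<omega>. \<bar>\<pi> U \<bullet> X \<omega>\<bar> \<partial>M) / 2" for U
    by (simp add: supp_zonoid_of[OF random_vector_vector_law[OF X]] integral_vector_law[OF X] \<pi>)
  have "czonoid_image (exterior_power A) ?K = ?K"
    by (rule czonoid_eqI) (simp only: supp_czonoid_image supp \<pi>_image inv)
  then show ?thesis by (simp add: vector_zonoid_def vzonoid_image_virtual)
qed

text \<open>Meaningful for \<open>K\<close> in \<open>grassmann_zonoids 1\<close>, since the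
  quotient is a partial one.\<close>

definition degree_one :: "(real ^ ('n set)) vzonoid \<Rightarrow> 'n::finite prob_algebra" where
  "degree_one K = abs_prob_algebra (\<lambda>d. if d = 1 then K else 0)"

lemma graded_zonoids_degree_one:
  assumes "K \<in> grassmann_zonoids 1" shows "(\<lambda>d. if d = 1 then K else 0) \<in> graded_zonoids"
proof -
  have "finite {d. (if d = 1 then K else 0) \<noteq> 0}" by (rule finite_subset[of _ "{1}"]) (auto split: if_splits)
  then show ?thesis using assms by (simp add: graded_zonoids_def subspace_0[OF subspace_grassmann_zonoids])
qed

lemma prob_action_degree_one:
  assumes "K \<in> grassmann_zonoids 1"
  shows "prob_action A (degree_one K) = degree_one (vzonoid_image (exterior_power A) K)"
proof -
  have "prob_action A (degree_one K) = abs_prob_algebra (\<lambda>d. vzonoid_image (exterior_power A) (if d = 1 then K else 0))"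
    unfolding degree_one_def
    by (rule prob_action.abs_eq[OF same_class_refl[OF graded_zonoids_degree_one[OF assms]]])
  also have "(\<lambda>d. vzonoid_image (exterior_power A) (if d = 1 then K else 0)) =
      (\<lambda>d. if d = 1 then vzonoid_image (exterior_power A) K else 0)"
    by (auto simp: linear_0[OF linear_vzonoid_image])
  finally show ?thesis by (simp add: degree_one_def)
qed

text \<open>Pairing with the segment of \<open>u\<close> descends to the quotient because that
  segment is itself a Grassmann zonoid, so null zonoids pair to 0 with it. The point mass merely
  supplies a probability space for the constant vector.\<close>

lift_definition evaluate :: "real ^ 'n \<Rightarrow> 'n::finite prob_algebra \<Rightarrow> real"
  is "\<lambda>u f. zonoid_pairing (f 1) (vector_zonoid (return borel (0::real)) (\<lambda>_. u))"
proof -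
  fix u :: "real ^ 'n" and f g :: "nat \<Rightarrow> (real ^ ('n set)) vzonoid"
  assume "same_class f g"
  then have "f 1 - g 1 \<in> null_zonoids 1" by (simp add: same_class_def)
  moreover have "vector_zonoid (return borel (0::real)) (\<lambda>_. u) \<in> grassmann_zonoids 1"
    by (rule vector_zonoid_in_grassmann_zonoids) (simp add: random_vector_def prob_space_return prob_space.finite_measure finite_measure.integrable_const)
  ultimately have "zonoid_pairing (f 1 - g 1) (vector_zonoid (return borel (0::real)) (\<lambda>_. u)) = 0"
    by (simp add: null_zonoids_def)
  then show "zonoid_pairing (f 1) (vector_zonoid (return borel (0::real)) (\<lambda>_. u)) =
      zonoid_pairing (g 1) (vector_zonoid (return borel (0::real)) (\<lambda>_. u))"
    by (simp add: bilinear_lsub[OF bilinear_zonoid_pairing])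
qed

lemma linear_evaluate: "linear (evaluate u)"
proof (rule linearI)
  show "evaluate u (X + Y) = evaluate u X + evaluate u Y" for X Y
    by transfer (simp add: bilinear_ladd[OF bilinear_zonoid_pairing])
  show "evaluate u (c *\<^sub>R X) = c *\<^sub>R evaluate u X" for c X
    by transfer (simp add: bilinear_lmul[OF bilinear_zonoid_pairing])
qed

lemma evaluate_degree_one_vector_zonoid:
  assumes "random_vector M X"
  shows "evaluate u (degree_one (vector_zonoid M X)) = (\<integral>\<omega>. \<bar>u \<bullet> X \<omega>\<bar> \<partial>M)"
proof -
  have "evaluate u (degree_one (vector_zonoid M X)) =
      zonoid_pairing (vector_zonoid M X) (vector_zonoid (return borel (0::real)) (\<lambda>_. u))"
    unfolding degree_one_def
    using evaluate.abs_eq[OF same_class_refl[OF graded_zonoids_degree_one[OF vector_zonoid_in_grassmann_zonoids[OF assms]]]]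
    by simp
  then show ?thesis by (simp add: zonoid_pairing_vector_zonoid_const[OF assms] prob_space_return)
qed

section \<open>An infinite dimensional space of invariants\<close>

text \<open>With \<open>u\<close> read as a matrix with rows indexed by \<open>'k\<close>, this is
  its transpose applied to \<open>x\<close>; in \<open>u\<close> it is adjoint to tensoring with
  \<open>x\<close>, see \<open>inner_outer\<close>.\<close>

definition contract :: "real ^ 'k \<Rightarrow> real ^ ('k \<times> 'm) \<Rightarrow> real ^ ('m::finite)" where
  "contract x u = (\<chi> j. \<Sum>i\<in>UNIV. x $ i * u $ (i, j))"

definition outer :: "real ^ 'k \<Rightarrow> real ^ 'm \<Rightarrow> real ^ ('k::finite \<times> 'm::finite)" where
  "outer x y = (\<chi> p. x $ fst p * y $ snd p)"

lemma sum_UNIV_prod: "(\<Sum>p\<in>UNIV. f p) = (\<Sum>i\<in>(UNIV :: 'a::finite set). \<Sum>j\<in>(UNIV :: 'b::finite set). f (i, j))"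
  by (simp add: sum.cartesian_product flip: UNIV_Times_UNIV)

lemma inner_outer: "u \<bullet> outer x y = contract x u \<bullet> y"
proof -
  have "u \<bullet> outer x y = (\<Sum>i\<in>UNIV. \<Sum>j\<in>UNIV. x $ i * u $ (i, j) * y $ j)"
    by (simp add: inner_vec_def outer_def sum_UNIV_prod mult_ac)
  also have "\<dots> = contract x u \<bullet> y"
    by (subst sum.swap) (simp add: inner_vec_def contract_def sum_distrib_right)
  finally show ?thesis .
qed

lemma transpose_tensor_matrix: "transpose (tensor_matrix g h) = tensor_matrix (transpose g) (transpose h)"
  by (simp add: tensor_matrix_def transpose_def)

lemma tensor_matrix_mult: "tensor_matrix g h ** tensor_matrix g' h' = tensor_matrix (g ** g') (h ** h')"
  by (simp add: tensor_matrix_def matrix_matrix_mult_def vec_eq_iff sum_UNIV_prod sum_product mult_ac)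

lemma tensor_matrix_one: "tensor_matrix (mat 1) (mat 1) = mat 1"
  by (auto simp: tensor_matrix_def mat_def vec_eq_iff)

lemma orthogonal_matrix_tensor_matrix:
  assumes "orthogonal_matrix g" "orthogonal_matrix h"
  shows "orthogonal_matrix (tensor_matrix g h)"
  using assms by (simp add: orthogonal_matrix transpose_tensor_matrix tensor_matrix_mult tensor_matrix_one)

lemma norm_orthogonal_matrix: "orthogonal_matrix A \<Longrightarrow> norm (A *v x) = norm (x :: real ^ 'n)"
  by (rule orthogonal_transformation_norm) (simp add: orthogonal_transformation_matrix)

lemma contract_tensor_matrix:
  "contract x (tensor_matrix g h *v u) = h *v contract (transpose g *v x) u"
proof -
  have "(\<Sum>i\<in>UNIV. x $ i * (\<Sum>k\<in>UNIV. \<Sum>l\<in>UNIV. g $ i $ k * h $ j $ l * u $ (k, l))) =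
      (\<Sum>l\<in>UNIV. h $ j $ l * (\<Sum>k\<in>UNIV. (\<Sum>i\<in>UNIV. g $ i $ k * x $ i) * u $ (k, l)))" for j
  proof -
    have "(\<Sum>i\<in>UNIV. x $ i * (\<Sum>k\<in>UNIV. \<Sum>l\<in>UNIV. g $ i $ k * h $ j $ l * u $ (k, l))) =
        (\<Sum>i\<in>UNIV. \<Sum>k\<in>UNIV. \<Sum>l\<in>UNIV. h $ j $ l * (g $ i $ k * x $ i * u $ (k, l)))"
      by (simp add: sum_distrib_left mult_ac)
    also have "\<dots> = (\<Sum>k\<in>UNIV. \<Sum>l\<in>UNIV. \<Sum>i\<in>UNIV. h $ j $ l * (g $ i $ k * x $ i * u $ (k, l)))"
      by (subst sum.swap, intro sum.cong refl, rule sum.swap)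
    also have "\<dots> = (\<Sum>l\<in>UNIV. \<Sum>k\<in>UNIV. \<Sum>i\<in>UNIV. h $ j $ l * (g $ i $ k * x $ i * u $ (k, l)))"
      by (rule sum.swap)
    finally show ?thesis by (simp add: sum_distrib_left sum_distrib_right)
  qed
  then show ?thesis
    by (simp add: contract_def tensor_matrix_def matrix_vector_mult_def vec_eq_iff transpose_def sum_UNIV_prod)
qed

text \<open>The pair of \<open>G\<close> and \<open>y\<close> is uniform in one ball of the product
  space, not in a product of two balls: its law must be invariant under the rotations that mix both
  components.\<close>

definition sample_space :: "((real ^ 'k) \<times> (real ^ ('k \<times> 'm)) \<times> (real ^ 'm)) measure" where
  "sample_space = (unif_ball :: (real ^ 'k::finite) measure) \<Otimes>\<^sub>M
     (unif_ball :: ((real ^ ('k \<times> 'm)) \<times> (real ^ 'm::finite)) measure)"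

definition sample_vector :: "real \<Rightarrow> (real ^ 'k) \<times> (real ^ ('k \<times> 'm)) \<times> (real ^ 'm) \<Rightarrow> real ^ ('k::finite \<times> 'm::finite)" where
  "sample_vector t = (\<lambda>(x, G, y). G + t *\<^sub>R outer x y)"

text \<open>For fixed \<open>x\<close> the sample vector is linear in \<open>z\<close>, so that
  \<open>integral_unif_ball_inner\<close> applies to the integral over \<open>z\<close>.\<close>

lemma inner_sample_vector: "u \<bullet> sample_vector t (x, z) = (u, t *\<^sub>R contract x u) \<bullet> z"
  by (cases z) (simp add: sample_vector_def inner_add_right inner_outer)

lemma continuous_sample_vector: "continuous_on S (sample_vector t)"
  unfolding sample_vector_def outer_def case_prod_beta
  by (intro continuous_intros)

lemma sets_sample_space [measurable_cong, simp]: "sets sample_space = sets borel"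
proof -
  have "sets sample_space = sets (borel \<Otimes>\<^sub>M borel)"
    unfolding sample_space_def by (rule sets_pair_measure_cong) simp_all
  then show ?thesis by (simp only: borel_prod)
qed

lemma random_vector_sample_vector:
  "random_vector sample_space (sample_vector t :: _ \<Rightarrow> real ^ ('k::finite \<times> 'm::finite))"
proof -
  let ?S = "sample_space :: ((real ^ 'k) \<times> (real ^ ('k \<times> 'm)) \<times> (real ^ 'm)) measure"
  let ?\<xi> = "sample_vector t :: _ \<Rightarrow> real ^ ('k \<times> 'm)"
  interpret X: prob_space "unif_ball :: (real ^ 'k) measure" by (rule prob_space_unif_ball)
  interpret Z: prob_space "unif_ball :: ((real ^ ('k \<times> 'm)) \<times> (real ^ 'm)) measure" by (rule prob_space_unif_ball)
  interpret XZ: pair_prob_space "unif_ball :: (real ^ 'k) measure"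
    "unif_ball :: ((real ^ ('k \<times> 'm)) \<times> (real ^ 'm)) measure" ..
  have prob: "prob_space ?S"
    unfolding sample_space_def by (rule XZ.prob_space_axioms)
  interpret prob_space ?S by (rule prob)
  \<comment> \<open>This compact set carries the law, and the continuous sample vector is bounded on
    it.\<close>
  let ?C = "cball 0 1 \<times> cball 0 1 :: ((real ^ 'k) \<times> (real ^ ('k \<times> 'm)) \<times> (real ^ 'm)) set"
  have "compact (?\<xi> ` ?C)"
    by (intro compact_continuous_image continuous_sample_vector compact_Times compact_cball)
  then obtain C where C: "\<And>v. v \<in> ?\<xi> ` ?C \<Longrightarrow> norm v \<le> C"
    using compact_imp_bounded[of "?\<xi> ` ?C"] unfolding bounded_iff by metis
  have "AE \<omega> in ?S. \<omega> \<in> ?C"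
    unfolding sample_space_def
  proof (rule XZ.AE_pair_measure)
    show "AE x in unif_ball. AE z in unif_ball. (x, z) \<in> ?C"
      using AE_unif_ball
    proof eventually_elim
      case (elim x)
      show ?case using AE_unif_ball by eventually_elim (use elim in simp)
    qed
    have "?C \<in> sets (unif_ball \<Otimes>\<^sub>M unif_ball)" by (rule pair_measureI) simp_all
    then show "{\<omega> \<in> space (unif_ball \<Otimes>\<^sub>M unif_ball). \<omega> \<in> ?C} \<in> sets (unif_ball \<Otimes>\<^sub>M unif_ball)"
      by (simp only: space_pair_measure space_unif_ball UNIV_Times_UNIV UNIV_I simp_thms Collect_mem_eq)
  qed
  then have "AE \<omega> in ?S. norm (?\<xi> \<omega>) \<le> C"
    by eventually_elim (intro C imageI)
  moreover have "?\<xi> \<in> borel_measurable ?S"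
    using borel_measurable_continuous_onI[OF continuous_sample_vector] by (simp add: measurable_cong_sets[OF sets_sample_space refl])
  ultimately have "integrable ?S ?\<xi>"
    by (rule integrable_const_bound)
  then show ?thesis using prob by (simp add: random_vector_def)
qed

lemma continuous_contract: "continuous_on S (\<lambda>x. contract x u)"
  unfolding contract_def by (intro continuous_intros)

text \<open>By Fubini, integrate over \<open>z\<close> first; the square root is the norm of the
  vector paired with \<open>z\<close>. The constant depends on neither \<open>t\<close> nor
  \<open>u\<close>.\<close>

lemma integral_sample_vector:
  obtains c where "c > 0"
    "\<And>t (u :: real ^ ('k::finite \<times> 'm::finite)).
       (\<integral>\<omega>. \<bar>u \<bullet> sample_vector t \<omega>\<bar> \<partial>sample_space) =
       c * (\<integral>x. sqrt ((norm u)\<^sup>2 + t\<^sup>2 * (norm (contract x u))\<^sup>2) \<partial>unif_ball)"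
proof -
  obtain c where c: "c > 0"
    "\<And>w. (\<integral>x. \<bar>w \<bullet> x\<bar> \<partial>(unif_ball :: ((real ^ ('k \<times> 'm)) \<times> (real ^ 'm)) measure)) = c * norm w"
    by (rule integral_unif_ball_inner) blast
  interpret X: prob_space "unif_ball :: (real ^ 'k) measure" by (rule prob_space_unif_ball)
  interpret Z: prob_space "unif_ball :: ((real ^ ('k \<times> 'm)) \<times> (real ^ 'm)) measure" by (rule prob_space_unif_ball)
  interpret XZ: pair_prob_space "unif_ball :: (real ^ 'k) measure"
    "unif_ball :: ((real ^ ('k \<times> 'm)) \<times> (real ^ 'm)) measure" ..
  have "(\<integral>\<omega>. \<bar>u \<bullet> sample_vector t \<omega>\<bar> \<partial>sample_space) =
       c * (\<integral>x. sqrt ((norm u)\<^sup>2 + t\<^sup>2 * (norm (contract x u))\<^sup>2) \<partial>unif_ball)" for t and u :: "real ^ ('k \<times> 'm)"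
  proof -
    have "integrable sample_space (\<lambda>\<omega>. \<bar>u \<bullet> sample_vector t \<omega>\<bar>)"
      by (intro integrable_abs integrable_inner_right random_vector_sample_vector[unfolded random_vector_def, THEN conjunct2])
    then have "integrable (unif_ball \<Otimes>\<^sub>M unif_ball) (\<lambda>(x, z). \<bar>u \<bullet> sample_vector t (x, z)\<bar>)"
      by (simp add: sample_space_def case_prod_unfold)
    from XZ.integral_fst[OF this]
    have "(\<integral>\<omega>. \<bar>u \<bullet> sample_vector t \<omega>\<bar> \<partial>sample_space) =
        (\<integral>x. (\<integral>z. \<bar>u \<bullet> sample_vector t (x, z)\<bar> \<partial>unif_ball) \<partial>unif_ball)"
      by (simp add: sample_space_def case_prod_unfold)
    also have "\<dots> = (\<integral>x. c * sqrt ((norm u)\<^sup>2 + t\<^sup>2 * (norm (contract x u))\<^sup>2) \<partial>unif_ball)"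
      by (simp add: inner_sample_vector c(2) norm_Pair power_mult_distrib)
    finally show ?thesis by simp
  qed
  then show ?thesis using that c(1) by blast
qed

definition invariant_class :: "real \<Rightarrow> ('k::finite \<times> 'm::finite) prob_algebra" where
  "invariant_class t = degree_one (vector_zonoid sample_space (sample_vector t))"

lemma invariant_class_in_prob_intersection_ring: "invariant_class t \<in> prob_intersection_ring"
proof -
  have "prob_action (tensor_matrix g h) (invariant_class t) = invariant_class t"
    if g: "orthogonal_matrix g" and h: "orthogonal_matrix h" for g :: "real ^ 'a ^ 'a" and h :: "real ^ 'b ^ 'b"
  proof -
    have rv: "random_vector sample_space (sample_vector t :: _ \<Rightarrow> real ^ ('a \<times> 'b))"
      by (rule random_vector_sample_vector)
    obtain c where c: "\<And>t (u :: real ^ ('a \<times> 'b)). (\<integral>\<omega>. \<bar>u \<bullet> sample_vector t \<omega>\<bar> \<partial>sample_space) =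
       c * (\<integral>x. sqrt ((norm u)\<^sup>2 + t\<^sup>2 * (norm (contract x u))\<^sup>2) \<partial>unif_ball)"
      by (rule integral_sample_vector) blast
    have gT: "orthogonal_matrix (transpose g)" "orthogonal_matrix (transpose h)"
      using g h orthogonal_matrix_transpose by auto
    have "(\<integral>\<omega>. \<bar>(transpose (tensor_matrix g h) *v u) \<bullet> sample_vector t \<omega>\<bar> \<partial>sample_space) =
        (\<integral>\<omega>. \<bar>u \<bullet> sample_vector t \<omega>\<bar> \<partial>sample_space)" for u
    proof -
      \<comment> \<open>The action enters through the transposes, so \<open>g\<close> itself acts on
        \<open>x\<close> here.\<close>
      have "(\<integral>x. sqrt ((norm u)\<^sup>2 + t\<^sup>2 * (norm (contract (g *v x) u))\<^sup>2) \<partial>unif_ball) =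
          (\<integral>x. sqrt ((norm u)\<^sup>2 + t\<^sup>2 * (norm (contract x u))\<^sup>2) \<partial>unif_ball)"
        by (rule integral_unif_ball_orthogonal_transformation[where f="(*v) g"])
           (use g in \<open>auto simp: orthogonal_transformation_matrix intro!: borel_measurable_continuous_onI continuous_intros continuous_contract\<close>)
      then show ?thesis
        using gT orthogonal_matrix_tensor_matrix[OF gT]
        by (simp add: c transpose_tensor_matrix contract_tensor_matrix norm_orthogonal_matrix del: transpose_matrix_vector)
    qed
    from vzonoid_image_vector_zonoid[OF rv this] show ?thesis
      by (simp add: invariant_class_def prob_action_degree_one[OF vector_zonoid_in_grassmann_zonoids[OF rv]])
  qed
  then show ?thesis by (simp add: prob_intersection_ring_def)
qed

theorem corollary8p1:
  assumes "CARD('k::finite) > 1" and "CARD('m::finite) > 1"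
  shows "subspace (prob_intersection_ring :: ('k \<times> 'm) prob_algebra set) \<and>
    \<not> (\<exists>B. finite B \<and> span B = (prob_intersection_ring :: ('k \<times> 'm) prob_algebra set))"
proof (intro conjI notI subspace_prob_intersection_ring)
  assume "\<exists>B. finite B \<and> span B = (prob_intersection_ring :: ('k \<times> 'm) prob_algebra set)"
  then obtain B where B: "finite B" "span B = (prob_intersection_ring :: ('k \<times> 'm) prob_algebra set)" by blast
  obtain i\<^sub>1 i\<^sub>2 :: 'k where i: "i\<^sub>1 \<noteq> i\<^sub>2"
    using assms(1) card_le_Suc0_iff_eq[of "UNIV :: 'k set"] by auto
  obtain j\<^sub>1 j\<^sub>2 :: 'm where j: "j\<^sub>1 \<noteq> j\<^sub>2"
    using assms(2) card_le_Suc0_iff_eq[of "UNIV :: 'm set"] by auto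
  \<comment> \<open>A matrix with singular values \<open>sqrt s\<close> and
    \<open>sqrt (1 - s)\<close>: its norm is 1 for every \<open>s\<close>, while its contractions
    depend on \<open>s\<close>. Both factors must have two distinct indices for this.\<close>
  define u :: "real \<Rightarrow> real ^ ('k \<times> 'm)" where
    "u s = sqrt s *\<^sub>R axis (i\<^sub>1, j\<^sub>1) 1 + sqrt (1 - s) *\<^sub>R axis (i\<^sub>2, j\<^sub>2) 1" for s
  define q :: "real \<Rightarrow> real ^ 'k \<Rightarrow> real" where "q s x = s * (x $ i\<^sub>1)\<^sup>2 + (1 - s) * (x $ i\<^sub>2)\<^sup>2" for s x
  have norm_u: "(norm (u s))\<^sup>2 = 1" if "0 < s" "s < 1" for s
    using that i unfolding power2_norm_eq_inner
    by (simp add: u_def inner_add_left inner_add_right inner_axis_axis)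
  have norm_contract: "(norm (contract x (u s)))\<^sup>2 = q s x" if "0 < s" "s < 1" for s x
  proof -
    have "contract x (u s) = (sqrt s * x $ i\<^sub>1) *\<^sub>R axis j\<^sub>1 1 + (sqrt (1 - s) * x $ i\<^sub>2) *\<^sub>R axis j\<^sub>2 1"
      by (auto simp: contract_def u_def axis_def vec_eq_iff algebra_simps sum.distrib if_distrib[of "\<lambda>x. _ * x"] cong: if_cong)
    then show ?thesis using that j unfolding power2_norm_eq_inner
      by (simp add: q_def inner_add_left inner_add_right inner_axis_axis power_mult_distrib power2_eq_square mult_ac)
  qed
  have "infinite {1 / 2 <..< 1 :: real}" by (rule infinite_Ioo) simp
  \<comment> \<open>One more evaluation point than elements of \<open>B\<close>, so that a
    nontrivial relation exists. Beyond 1/2 the larger of \<open>s\<close> and \<open>1 - s\<close>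
    is \<open>s\<close>, which separates the essential suprema.\<close>
  then obtain J where J: "finite J" "card J = Suc (card B)" "J \<subseteq> {1 / 2 <..< 1 :: real}"
    using infinite_arbitrarily_large by blast
  obtain c\<^sub>J where cJ: "\<exists>s\<in>J. c\<^sub>J s \<noteq> 0" "\<And>b. b \<in> B \<Longrightarrow> (\<Sum>s\<in>J. c\<^sub>J s * evaluate (u s) b) = 0"
    using exists_annihilating_combination[OF B(1) J(1), of "\<lambda>s. evaluate (u s)"] J(2) by auto
  define F where "F X = (\<Sum>s\<in>J. c\<^sub>J s *\<^sub>R evaluate (u s) X)" for X
  have "linear F" unfolding F_def
    by (intro linear_compose_sum ballI linear_compose_scale_right linear_evaluate)
  then have F: "F X = 0" if "X \<in> prob_intersection_ring" for X
    using linear_eq_0_on_span[of F B X] that cJ(2) B(2) by (auto simp: F_def)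
  obtain c where c: "c > 0" "\<And>t (u :: real ^ ('k \<times> 'm)). (\<integral>\<omega>. \<bar>u \<bullet> sample_vector t \<omega>\<bar> \<partial>sample_space) =
       c * (\<integral>x. sqrt ((norm u)\<^sup>2 + t\<^sup>2 * (norm (contract x u))\<^sup>2) \<partial>unif_ball)"
    by (rule integral_sample_vector) blast
  have eq: "(\<Sum>s\<in>J. c\<^sub>J s * (\<integral>x. sqrt (1 + t * q s x) \<partial>unif_ball)) = 0" if t: "0 < t" "t < 1" for t
  proof -
    \<comment> \<open>The parameter \<open>sqrt t\<close> makes \<open>t\<close> the variable of the
      power series.\<close>
    have "evaluate (u s) (invariant_class (sqrt t)) = c * (\<integral>x. sqrt (1 + t * q s x) \<partial>unif_ball)" if "s \<in> J" for s
    proof -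
      have "0 < s" "s < 1" using J(3) that by auto
      then show ?thesis using t
        by (simp add: invariant_class_def evaluate_degree_one_vector_zonoid random_vector_sample_vector c(2) norm_u norm_contract)
    qed
    then have "F (invariant_class (sqrt t)) = c * (\<Sum>s\<in>J. c\<^sub>J s * (\<integral>x. sqrt (1 + t * q s x) \<partial>unif_ball))"
      by (simp add: F_def sum_distrib_left mult_ac)
    then show ?thesis using F[OF invariant_class_in_prob_intersection_ring] c(1) by simp
  qed
  interpret prob_space "unif_ball :: (real ^ 'k) measure" by (rule prob_space_unif_ball)
  have cont: "continuous_on UNIV (q s)" for s unfolding q_def by (intro continuous_intros)
  then have meas: "q s \<in> borel_measurable unif_ball" for s
    using borel_measurable_continuous_onI[OF cont, of s] by simp
  have q_bounds: "AE x in unif_ball. 0 \<le> q s x \<and> q s x \<le> s" if "s \<in> J" for s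
    using AE_unif_ball
  proof eventually_elim
    case (elim x)
    have s: "1 / 2 < s" "s < 1" using J(3) that by auto
    have "(x $ i\<^sub>1)\<^sup>2 + (x $ i\<^sub>2)\<^sup>2 = (\<Sum>i\<in>{i\<^sub>1, i\<^sub>2}. (x $ i)\<^sup>2)" using i by simp
    also have "\<dots> \<le> (\<Sum>i\<in>UNIV. (x $ i)\<^sup>2)" by (rule sum_mono2) auto
    also have "\<dots> = (norm x)\<^sup>2"
      unfolding power2_norm_eq_inner inner_vec_def by (simp add: power2_eq_square)
    also have "\<dots> \<le> 1" using elim by (simp add: power_le_one)
    finally have le: "(x $ i\<^sub>1)\<^sup>2 + (x $ i\<^sub>2)\<^sup>2 \<le> 1" .
    have "q s x \<le> s * (x $ i\<^sub>1)\<^sup>2 + s * (x $ i\<^sub>2)\<^sup>2"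
      unfolding q_def using s by (intro add_left_mono mult_right_mono) auto
    also have "\<dots> \<le> s" using mult_left_mono[OF le, of s] s by (simp add: distrib_left)
    finally show ?case using s by (simp add: q_def)
  qed
  have pos: "0 < prob {x \<in> space unif_ball. r < q s x}" if "s \<in> J" "r < s" for s r
  proof -
    have s: "0 < s" using J(3) that by auto
    \<comment> \<open>The point \<open>sqrt \<rho>\<close> times a unit vector should lie in the
      open ball and satisfy \<open>q s x = s * \<rho> > r\<close>. As \<open>r\<close> may be
      negative, positivity of \<open>\<rho>\<close> is imposed separately.\<close>
    have "max 0 (r / s) < 1" using that s by simp
    then obtain \<rho> where \<rho>: "0 < \<rho>" "r / s < \<rho>" "\<rho> < 1" using dense by (metis max_less_iff_conj)
    have "q s (sqrt \<rho> *\<^sub>R axis i\<^sub>1 1) = s * \<rho>" using \<rho>(1) i by (simp add: q_def axis_def)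
    moreover have "r < s * \<rho>" using \<rho>(2) s by (simp add: divide_less_eq mult.commute)
    ultimately have "sqrt \<rho> *\<^sub>R axis i\<^sub>1 1 \<in> {x. r < q s x}" by simp
    moreover have "open {x. r < q s x}" by (intro open_Collect_less continuous_on_const cont)
    moreover have "norm (sqrt \<rho> *\<^sub>R axis i\<^sub>1 (1 :: real)) < 1" using \<rho> by (simp add: norm_axis_1)
    ultimately have "0 < prob {x. r < q s x}" using unif_ball_pos by blast
    then show ?thesis by simp
  qed
  have "AE x in unif_ball. \<bar>q s x\<bar> \<le> 1" if "s \<in> J" for s
    using q_bounds[OF that] by eventually_elim (use J(3) that in auto)
  from moments_eq_0[OF meas this eq]
  have moments: "(\<Sum>s\<in>J. c\<^sub>J s * expectation (\<lambda>x. q s x ^ n)) = 0" for n by blast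
  have "c\<^sub>J s = 0" if "s \<in> J" for s
  proof (rule coefficients_eq_0_if_moments_eq_0[OF J(1) _ meas q_bounds pos moments that])
    show "0 < s" if "s \<in> J" for s using J(3) that by auto
  qed
  then show False using cJ(1) by blast
qed

end
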